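(* Let $\mathcal{T}^d=(\mathcal{N},\mathcal{E},d)$ be any oriented tree diagram, let $L_0(\mathcal{T}^d)$ be the associated Lie algebra, let $H(L_0(\mathcal{T}^d))=\bigoplus_{p\ge 0}H^p(L_0(\mathcal{T}^d))$ be its Lie algebra cohomology with trivial coefficients, and let $C(L_0(\mathcal{T}^d))$ be its center. Then $$\dim H(L_0(\mathcal{T}^d))\ \geq\ 2^{\dim C(L_0(\mathcal{T}^d))}.$$
   Context: Everything is over $\mathbb{C}$. An oriented tree is a pair $(\mathcal{N},\mathcal{E})$ with $\mathcal{N}=\{\iota_1,\dots,\iota_n\}$ (nodes) and $\mathcal{E}\subset\{(\iota_i,\iota_j)\mid 1\le i<j\le n\}$ (oriented edges) such that the underlying undirected graph is connected and has no cycles. An oriented tree diagram $\mathcal{T}^d=(\mathcal{N},\mathcal{E},d)$ is an oriented tree together with a weight map $d:\mathcal{E}\to\mathbb{Z}_+$ (positive integers). A node $\iota$ is a root node if there is no edge $(\iota',\iota)\in\mathcal{E}$; $\Lambda$ denotes the set of root nodes. The Lie algebra $L_0(\mathcal{T}^d)$ is the Lie subalgebra, under the commutator bracket $[A,B]=AB-BA$, of the algebra of differential operators in $x_1,\dots,x_n$ with coefficients in $\mathbb{C}[x_1,\dots,x_n]$, generated by $$\{\partial_{x_i},\ x_j^{d[(\iota_j,\iota_k)]}\partial_{x_k}\mid \iota_i\in\Lambda,\ (\iota_j,\iota_k)\in\mathcal{E}\}.$$ It is a finite-dimensional nilpotent Lie algebra. Cohomology is Chevalley–Eilenberg cohomology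 with coefficients in the trivial module $\mathbb{C}$. *)

theory Defs
  imports "HOL-Library.Poly_Mapping" "HOL-Algebra.AbelCoset" "Jordan_Normal_Form.VS_Connect"
begin

section \<open>Oriented tree diagrams\<close>

text \<open>The node \<open>\<iota>\<^sub>i\<close> is represented by its index \<open>i \<in> {1..n}\<close>. Edges point from smaller to larger
  indices, so the underlying undirected graph is simple.\<close>

definition adjacent :: "(nat \<times> nat) set \<Rightarrow> (nat \<times> nat) set" where
  "adjacent E = E \<union> E\<inverse>"

definition is_cycle :: "(nat \<times> nat) set \<Rightarrow> nat list \<Rightarrow> bool" where
  "is_cycle E vs \<longleftrightarrow> 3 \<le> length vs \<and> distinct vs \<and>
     (\<forall>k < length vs. (vs ! k, vs ! (Suc k mod length vs)) \<in> adjacent E)"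

definition oriented_tree :: "nat \<Rightarrow> (nat \<times> nat) set \<Rightarrow> bool" where
  "oriented_tree n E \<longleftrightarrow>
     1 \<le> n \<and>
     E \<subseteq> {(i, j). 1 \<le> i \<and> i < j \<and> j \<le> n} \<and>
     (\<forall>i \<in> {1..n}. \<forall>j \<in> {1..n}. (i, j) \<in> (adjacent E)\<^sup>*) \<and>
     (\<nexists>vs. is_cycle E vs)"

definition oriented_tree_diagram ::
  "nat \<Rightarrow> (nat \<times> nat) set \<Rightarrow> (nat \<times> nat \<Rightarrow> nat) \<Rightarrow> bool" where
  "oriented_tree_diagram n E d \<longleftrightarrow> oriented_tree n E \<and> (\<forall>e \<in> E. 0 < d e)"

definition root_nodes :: "nat \<Rightarrow> (nat \<times> nat) set \<Rightarrow> nat set" where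
  "root_nodes n E = {i \<in> {1..n}. \<nexists>j. (j, i) \<in> E}"


section \<open>Lie algebras\<close>

text \<open>Complex vector spaces are module records over \<^term>\<open>class_ring :: complex ring\<close>. The ring
  multiplication and unit of such a record play no role.\<close>

abbreviation cdim :: "(complex, 'a, 'b) module_scheme \<Rightarrow> nat" where
  "cdim V \<equiv> vectorspace.dim (class_ring :: complex ring) V"

record 'a lie_algebra = "(complex, 'a) module" +
  bracket :: "'a \<Rightarrow> 'a \<Rightarrow> 'a"

text \<open>Carrier of the Lie subalgebra of \<open>A\<close> generated by \<open>G\<close>.\<close>

inductive_set lie_span :: "'a lie_algebra \<Rightarrow> 'a set \<Rightarrow> 'a set"
  for A :: "'a lie_algebra" and G :: "'a set" where
  gen: "x \<in> G \<Longrightarrow> x \<in> lie_span A G"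
| zero: "\<zero>\<^bsub>A\<^esub> \<in> lie_span A G"
| add: "x \<in> lie_span A G \<Longrightarrow> y \<in> lie_span A G \<Longrightarrow> x \<oplus>\<^bsub>A\<^esub> y \<in> lie_span A G"
| smult: "x \<in> lie_span A G \<Longrightarrow> c \<odot>\<^bsub>A\<^esub> x \<in> lie_span A G"
| bracket: "x \<in> lie_span A G \<Longrightarrow> y \<in> lie_span A G \<Longrightarrow> bracket A x y \<in> lie_span A G"

definition lie_center :: "'a lie_algebra \<Rightarrow> 'a lie_algebra" where
  "lie_center L = L\<lparr>carrier := {z \<in> carrier L. \<forall>x \<in> carrier L. bracket L z x = \<zero>\<^bsub>L\<^esub>}\<rparr>"


section \<open>Chevalley--Eilenberg cohomology with trivial coefficients\<close>

definition tuples :: "'a lie_algebra \<Rightarrow> nat \<Rightarrow> 'a list set" where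
  "tuples L p = {xs. length xs = p \<and> set xs \<subseteq> carrier L}"

text \<open>A \<open>p\<close>-cochain is an alternating \<open>p\<close>-linear form on \<open>L\<close>, extended by \<open>0\<close> to lists that are
  not \<open>p\<close>-tuples of elements of \<open>L\<close>.\<close>

definition cochains :: "'a lie_algebra \<Rightarrow> nat \<Rightarrow> ('a list \<Rightarrow> complex) set" where
  "cochains L p = {f.
     (\<forall>xs. xs \<notin> tuples L p \<longrightarrow> f xs = 0) \<and>
     (\<forall>xs \<in> tuples L p. \<forall>i < p. \<forall>x \<in> carrier L. \<forall>y \<in> carrier L.
        f (xs[i := x \<oplus>\<^bsub>L\<^esub> y]) = f (xs[i := x]) + f (xs[i := y])) \<and>
     (\<forall>xs \<in> tuples L p. \<forall>i < p. \<forall>c. \<forall>x \<in> carrier L.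
        f (xs[i := c \<odot>\<^bsub>L\<^esub> x]) = c * f (xs[i := x])) \<and>
     (\<forall>xs \<in> tuples L p. \<forall>i < p. \<forall>j < p. i \<noteq> j \<and> xs ! i = xs ! j \<longrightarrow> f xs = 0)}"

definition cochain_space :: "'a lie_algebra \<Rightarrow> nat \<Rightarrow> (complex, 'a list \<Rightarrow> complex) module" where
  "cochain_space L p =
     \<lparr>carrier = cochains L p, mult = undefined, one = undefined,
      zero = (\<lambda>xs. 0), add = (\<lambda>f g xs. f xs + g xs), smult = (\<lambda>c f xs. c * f xs)\<rparr>"

text \<open>The differential from \<open>p\<close>-cochains to \<open>(p + 1)\<close>-cochains. The list \<open>nths xs (- {i, j})\<close> is
  \<open>xs\<close> with its entries at the positions \<open>i\<close> and \<open>j\<close> (counted from \<open>0\<close>) deleted.\<close>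

definition ce_diff ::
  "'a lie_algebra \<Rightarrow> nat \<Rightarrow> ('a list \<Rightarrow> complex) \<Rightarrow> 'a list \<Rightarrow> complex" where
  "ce_diff L p f xs =
     (if xs \<in> tuples L (Suc p)
      then \<Sum>(i, j) \<in> {(i, j). i < j \<and> j \<le> p}.
             (-1) ^ (i + j) * f (bracket L (xs ! i) (xs ! j) # nths xs (- {i, j}))
      else 0)"

definition cocycles :: "'a lie_algebra \<Rightarrow> nat \<Rightarrow> ('a list \<Rightarrow> complex) set" where
  "cocycles L p = {f \<in> cochains L p. \<forall>xs. ce_diff L p f xs = 0}"

definition coboundaries :: "'a lie_algebra \<Rightarrow> nat \<Rightarrow> ('a list \<Rightarrow> complex) set" where
  "coboundaries L p =
     (case p of 0 \<Rightarrow> {\<lambda>xs. 0} | Suc q \<Rightarrow> ce_diff L q ` cochains L q)"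

definition quotient_space ::
  "(complex, 'v) module \<Rightarrow> 'v set \<Rightarrow> (complex, 'v set) module" where
  "quotient_space V W =
     \<lparr>carrier = a_rcosets\<^bsub>V\<^esub> W, mult = undefined, one = undefined,
      zero = W, add = set_add V,
      smult = (\<lambda>c X. \<Union>x \<in> X. W +>\<^bsub>V\<^esub> (c \<odot>\<^bsub>V\<^esub> x))\<rparr>"

definition cohomology ::
  "'a lie_algebra \<Rightarrow> nat \<Rightarrow> (complex, ('a list \<Rightarrow> complex) set) module" where
  "cohomology L p =
     quotient_space ((cochain_space L p)\<lparr>carrier := cocycles L p\<rparr>) (coboundaries L p)"

text \<open>External direct sum: finitely supported families.\<close>

definition graded_sum :: "(nat \<Rightarrow> (complex, 'v) module) \<Rightarrow> (complex, nat \<Rightarrow> 'v) module" where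
  "graded_sum V =
     \<lparr>carrier = {h. (\<forall>p. h p \<in> carrier (V p)) \<and> finite {p. h p \<noteq> \<zero>\<^bsub>V p\<^esub>}},
      mult = undefined, one = undefined,
      zero = (\<lambda>p. \<zero>\<^bsub>V p\<^esub>),
      add = (\<lambda>g h p. g p \<oplus>\<^bsub>V p\<^esub> h p),
      smult = (\<lambda>c h p. c \<odot>\<^bsub>V p\<^esub> h p)\<rparr>"

definition total_cohomology ::
  "'a lie_algebra \<Rightarrow> (complex, nat \<Rightarrow> ('a list \<Rightarrow> complex) set) module" where
  "total_cohomology L = graded_sum (cohomology L)"


section \<open>Differential operators and the Lie algebra of a tree diagram\<close>

text \<open>Polynomials in the variables \<open>x\<^sub>i\<close>, \<open>i \<in> \<nat>\<close>: finitely supported coefficient functions on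
  exponent vectors, with the convolution product.\<close>

type_synonym cpoly = "(nat \<Rightarrow>\<^sub>0 nat) \<Rightarrow>\<^sub>0 complex"

type_synonym operator = "cpoly \<Rightarrow> cpoly"

definition const :: "complex \<Rightarrow> cpoly" where
  "const c = Poly_Mapping.single 0 c"

definition var :: "nat \<Rightarrow> cpoly" where
  "var i = Poly_Mapping.single (Poly_Mapping.single i 1) 1"

text \<open>The partial derivative with respect to \<open>x\<^sub>i\<close>. Monomials without \<open>x\<^sub>i\<close> contribute \<open>0\<close>, so the
  truncated subtraction of exponents is harmless.\<close>

definition pderiv_op :: "nat \<Rightarrow> operator" where
  "pderiv_op i p =
     (\<Sum>m \<in> Poly_Mapping.keys p.
        Poly_Mapping.single (m - Poly_Mapping.single i 1)
          (of_nat (Poly_Mapping.lookup m i) * Poly_Mapping.lookup p m))"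

text \<open>The algebra of differential operators in \<open>x\<^sub>1, \<dots>, x\<^sub>n\<close> with polynomial coefficients, i.e. the
  algebra generated by the \<open>x\<^sub>i\<close> and the \<open>\<partial>\<^sub>i\<close>, \<open>1 \<le> i \<le> n\<close>. It acts faithfully on polynomials in
  characteristic \<open>0\<close>, also on those involving further variables, and is identified with its image
  in the linear operators.\<close>

inductive_set diff_ops :: "nat \<Rightarrow> operator set" for n :: nat where
  scalar: "(\<lambda>p. const c * p) \<in> diff_ops n"
| var: "i \<in> {1..n} \<Longrightarrow> (\<lambda>p. var i * p) \<in> diff_ops n"
| pderiv: "i \<in> {1..n} \<Longrightarrow> pderiv_op i \<in> diff_ops n"
| add: "S \<in> diff_ops n \<Longrightarrow> T \<in> diff_ops n \<Longrightarrow> (\<lambda>p. S p + T p) \<in> diff_ops n"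
| comp: "S \<in> diff_ops n \<Longrightarrow> T \<in> diff_ops n \<Longrightarrow> S \<circ> T \<in> diff_ops n"

definition diff_op_algebra :: "nat \<Rightarrow> operator lie_algebra" where
  "diff_op_algebra n =
     \<lparr>carrier = diff_ops n, mult = (\<circ>), one = id,
      zero = (\<lambda>p. 0), add = (\<lambda>S T p. S p + T p), smult = (\<lambda>c T p. const c * T p),
      bracket = (\<lambda>S T p. (S \<circ> T) p - (T \<circ> S) p)\<rparr>"

definition tree_generators ::
  "nat \<Rightarrow> (nat \<times> nat) set \<Rightarrow> (nat \<times> nat \<Rightarrow> nat) \<Rightarrow> operator set" where
  "tree_generators n E d =
     {pderiv_op i | i. i \<in> root_nodes n E} \<union>
     {(\<lambda>p. var j ^ d (j, k) * pderiv_op k p) | j k. (j, k) \<in> E}"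

definition tree_lie_algebra ::
  "nat \<Rightarrow> (nat \<times> nat) set \<Rightarrow> (nat \<times> nat \<Rightarrow> nat) \<Rightarrow> operator lie_algebra" where
  "tree_lie_algebra n E d =
     (diff_op_algebra n)\<lparr>carrier := lie_span (diff_op_algebra n) (tree_generators n E d)\<rparr>"

end

theory Submission
  imports Defs
begin

text \<open>
  The algebra \<open>L\<close> of a tree diagram has a basis of monomial vector fields
  \<open>x\<^sup>a \<partial>\<^sub>k\<close>, where \<open>x\<^sup>a\<close> only involves
  variables \<open>x\<^sub>i\<close> with \<open>i < k\<close> that belong to nodes with an
  outgoing edge. Call a node without outgoing edges a sink. The bound follows by comparing both
  dimensions with the number \<open>s\<close> of sinks.

  Starting from the roots, bracketing shows that every \<open>\<partial>\<^sub>k\<close> lies in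
  \<open>L\<close>. Commuting with all of them forces a central element to have constant
  coefficients, and commuting with \<open>x\<^sub>k\<^sup>d \<partial>\<^sub>l\<close> for an edge
  \<open>(k, l)\<close> kills the coefficient of \<open>\<partial>\<^sub>k\<close>. Only the
  \<open>\<partial>\<^sub>k\<close> at sinks survive, so the centre has dimension at most
  \<open>s\<close> (\<open>dim_center_le\<close>).

  For a sink \<open>k\<close>, the basis fields in direction \<open>\<partial>\<^sub>k\<close>
  span an abelian ideal \<open>V\<^sub>k\<close>, and the ideals of different sinks commute,
  because no coefficient involves the variable of a sink. For a set \<open>S\<close> of sinks let
  \<open>\<omega>\<^sub>S\<close> be the wedge product of the coordinates on the sum of the
  \<open>V\<^sub>k\<close> with \<open>k \<in> S\<close>. It is closed because \<open>L\<close>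
  acts on this ideal by strictly triangular, hence traceless, maps
  (\<open>volume_form_cocycle\<close>). A coboundary vanishes at every tuple of commuting vectors
  (\<open>coboundary_vanishes_on_commuting\<close>), whereas \<open>\<omega>\<^sub>S\<close> has
  value \<open>1\<close> at the basis of its own ideal and \<open>0\<close> at the basis of the
  ideal of any other set of the same total dimension. So the \<open>2\<^sup>s\<close> classes of
  the \<open>\<omega>\<^sub>S\<close> are linearly independent
  (\<open>card_le_dim_total_cohomology\<close>, \<open>two_power_card_sinks_le_dim\<close>).

  A bound for the dimension from below is only meaningful once the space is known to be
  finite-dimensional. That the monomial fields in \<open>L\<close> are finite in number follows
  from a grading: give \<open>x\<^sub>i\<close> the degree \<open>Q\<^sup>i\<close> for some
  \<open>Q\<close> not below any edge weight. Then \<open>x\<^sup>a\<close> has degree at most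
  \<open>Q\<^sup>k\<close> in every \<open>x\<^sup>a \<partial>\<^sub>k\<close> of the basis, and
  a cochain is determined by finitely many values.
\<close>

section \<open>Dimension bounds from functionals\<close>

definition linear_functional :: "(complex, 'v, 'm) module_scheme \<Rightarrow> ('v \<Rightarrow> complex) \<Rightarrow> bool" where
  "linear_functional V e \<longleftrightarrow>
     (\<forall>v \<in> carrier V. \<forall>w \<in> carrier V. e (v \<oplus>\<^bsub>V\<^esub> w) = e v + e w) \<and>
     (\<forall>c. \<forall>v \<in> carrier V. e (c \<odot>\<^bsub>V\<^esub> v) = c * e v)"

lemma linear_functional_add:
  "linear_functional V e \<Longrightarrow> v \<in> carrier V \<Longrightarrow> w \<in> carrier V \<Longrightarrow> e (v \<oplus>\<^bsub>V\<^esub> w) = e v + e w"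
  by (simp add: linear_functional_def)

lemma linear_functional_smult:
  "linear_functional V e \<Longrightarrow> v \<in> carrier V \<Longrightarrow> e (c \<odot>\<^bsub>V\<^esub> v) = c * e v"
  by (simp add: linear_functional_def)

lemma complex_vectorspaceI:
  fixes V :: "(complex, 'v, 'm) module_scheme"
  assumes zero: "\<zero>\<^bsub>V\<^esub> \<in> carrier V"
    and add: "\<And>v w. v \<in> carrier V \<Longrightarrow> w \<in> carrier V \<Longrightarrow> v \<oplus>\<^bsub>V\<^esub> w \<in> carrier V"
    and smult: "\<And>c v. v \<in> carrier V \<Longrightarrow> c \<odot>\<^bsub>V\<^esub> v \<in> carrier V"
    and comm: "\<And>v w. v \<in> carrier V \<Longrightarrow> w \<in> carrier V \<Longrightarrow> v \<oplus>\<^bsub>V\<^esub> w = w \<oplus>\<^bsub>V\<^esub> v"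
    and assoc: "\<And>v w x. v \<in> carrier V \<Longrightarrow> w \<in> carrier V \<Longrightarrow> x \<in> carrier V \<Longrightarrow>
      (v \<oplus>\<^bsub>V\<^esub> w) \<oplus>\<^bsub>V\<^esub> x = v \<oplus>\<^bsub>V\<^esub> (w \<oplus>\<^bsub>V\<^esub> x)"
    and add_0: "\<And>v. v \<in> carrier V \<Longrightarrow> v \<oplus>\<^bsub>V\<^esub> \<zero>\<^bsub>V\<^esub> = v"
    and smult_0: "\<And>v. v \<in> carrier V \<Longrightarrow> 0 \<odot>\<^bsub>V\<^esub> v = \<zero>\<^bsub>V\<^esub>"
    and smult_1: "\<And>v. v \<in> carrier V \<Longrightarrow> 1 \<odot>\<^bsub>V\<^esub> v = v"
    and smult_assoc: "\<And>a c v. v \<in> carrier V \<Longrightarrow> (a * c) \<odot>\<^bsub>V\<^esub> v = a \<odot>\<^bsub>V\<^esub> (c \<odot>\<^bsub>V\<^esub> v)"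
    and l_distr: "\<And>a c v. v \<in> carrier V \<Longrightarrow> (a + c) \<odot>\<^bsub>V\<^esub> v = a \<odot>\<^bsub>V\<^esub> v \<oplus>\<^bsub>V\<^esub> c \<odot>\<^bsub>V\<^esub> v"
    and r_distr: "\<And>c v w. v \<in> carrier V \<Longrightarrow> w \<in> carrier V \<Longrightarrow>
      c \<odot>\<^bsub>V\<^esub> (v \<oplus>\<^bsub>V\<^esub> w) = c \<odot>\<^bsub>V\<^esub> v \<oplus>\<^bsub>V\<^esub> c \<odot>\<^bsub>V\<^esub> w"
  shows "vectorspace class_ring V"
proof (rule vs_criteria)
  show "field (class_ring :: complex ring)" by (rule class_field.field_axioms)
  show "\<forall>v\<in>carrier V. \<exists>neg_v\<in>carrier V. v \<oplus>\<^bsub>V\<^esub> neg_v = \<zero>\<^bsub>V\<^esub>"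
  proof
    fix v assume v: "v \<in> carrier V"
    have "v \<oplus>\<^bsub>V\<^esub> (- 1) \<odot>\<^bsub>V\<^esub> v = \<zero>\<^bsub>V\<^esub>"
      using l_distr[OF v, of 1 "- 1"] smult_1[OF v] smult_0[OF v] by simp
    then show "\<exists>neg_v\<in>carrier V. v \<oplus>\<^bsub>V\<^esub> neg_v = \<zero>\<^bsub>V\<^esub>" using smult[OF v] by blast
  qed
qed (use assms in auto)

text \<open>The image of a vector space under a map that respects the operations satisfies the vector space
  axioms. This spares a separate verification of the axioms for a quotient: it is the image of the
  projection.\<close>

lemma linear_map_onto_image:
  fixes V :: "(complex, 'v, 'm) module_scheme" and W :: "(complex, 'w, 'k) module_scheme"
  assumes V: "vectorspace class_ring V"
    and surj: "f ` carrier V = carrier W"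
    and zero: "f \<zero>\<^bsub>V\<^esub> = \<zero>\<^bsub>W\<^esub>"
    and add: "\<And>v w. v \<in> carrier V \<Longrightarrow> w \<in> carrier V \<Longrightarrow> f (v \<oplus>\<^bsub>V\<^esub> w) = f v \<oplus>\<^bsub>W\<^esub> f w"
    and smult: "\<And>c v. v \<in> carrier V \<Longrightarrow> f (c \<odot>\<^bsub>V\<^esub> v) = c \<odot>\<^bsub>W\<^esub> f v"
  shows "linear_map class_ring V W f"
proof -
  interpret V: vectorspace class_ring V by (rule V)
  have car: "f v \<in> carrier W" if "v \<in> carrier V" for v using surj that by blast
  have ex: "\<exists>v \<in> carrier V. w = f v" if "w \<in> carrier W" for w using surj that by blast
  have W: "vectorspace class_ring W"
  proof (rule complex_vectorspaceI)
    show "\<zero>\<^bsub>W\<^esub> \<in> carrier W" using car[OF V.M.zero_closed] zero by simp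
  next
    fix v w assume "v \<in> carrier W" "w \<in> carrier W"
    then obtain v' w' where v: "v' \<in> carrier V" "v = f v'" "w' \<in> carrier V" "w = f w'"
      using ex by blast
    show "v \<oplus>\<^bsub>W\<^esub> w \<in> carrier W" using car[of "v' \<oplus>\<^bsub>V\<^esub> w'"] add v by simp
    show "v \<oplus>\<^bsub>W\<^esub> w = w \<oplus>\<^bsub>W\<^esub> v"
      using add[of v' w'] add[of w' v'] V.M.a_comm[of v' w'] v by simp
    show "c \<odot>\<^bsub>W\<^esub> (v \<oplus>\<^bsub>W\<^esub> w) = c \<odot>\<^bsub>W\<^esub> v \<oplus>\<^bsub>W\<^esub> c \<odot>\<^bsub>W\<^esub> w" for c
      using smult[of "v' \<oplus>\<^bsub>V\<^esub> w'" c] add[of v' w'] add[of "c \<odot>\<^bsub>V\<^esub> v'" "c \<odot>\<^bsub>V\<^esub> w'"]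
        smult[of v' c] smult[of w' c] V.smult_r_distr[of c v' w'] v by simp
    fix x assume "x \<in> carrier W"
    then obtain x' where x: "x' \<in> carrier V" "x = f x'" using ex by blast
    show "(v \<oplus>\<^bsub>W\<^esub> w) \<oplus>\<^bsub>W\<^esub> x = v \<oplus>\<^bsub>W\<^esub> (w \<oplus>\<^bsub>W\<^esub> x)"
      using add[of v' w'] add[of w' x'] add[of "v' \<oplus>\<^bsub>V\<^esub> w'" x'] add[of v' "w' \<oplus>\<^bsub>V\<^esub> x'"]
        V.M.a_assoc[of v' w' x'] v x by simp
  next
    fix v assume "v \<in> carrier W"
    then obtain v' where v: "v' \<in> carrier V" "v = f v'" using ex by blast
    show "v \<oplus>\<^bsub>W\<^esub> \<zero>\<^bsub>W\<^esub> = v" using add[of v' "\<zero>\<^bsub>V\<^esub>"] zero v by simp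
    show "0 \<odot>\<^bsub>W\<^esub> v = \<zero>\<^bsub>W\<^esub>" using smult[of v' 0] V.lmult_0[of v'] zero v by simp
    show "1 \<odot>\<^bsub>W\<^esub> v = v" using smult[of v' 1] V.smult_one[of v'] v by simp
    show "c \<odot>\<^bsub>W\<^esub> v \<in> carrier W" for c using smult[of v' c] car[of "c \<odot>\<^bsub>V\<^esub> v'"] v by simp
    show "(a * c) \<odot>\<^bsub>W\<^esub> v = a \<odot>\<^bsub>W\<^esub> (c \<odot>\<^bsub>W\<^esub> v)" for a c
      using smult[of v' "a * c"] smult[of v' c] smult[of "c \<odot>\<^bsub>V\<^esub> v'" a] V.smult_assoc1[of a c v'] v
      by simp
    show "(a + c) \<odot>\<^bsub>W\<^esub> v = a \<odot>\<^bsub>W\<^esub> v \<oplus>\<^bsub>W\<^esub> c \<odot>\<^bsub>W\<^esub> v" for a c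
      using smult[of v' "a + c"] smult[of v' c] smult[of v' a] V.smult_l_distr[of a c v'] v
        add[of "a \<odot>\<^bsub>V\<^esub> v'" "c \<odot>\<^bsub>V\<^esub> v'"] by simp
  qed
  have "f \<in> LinearCombinations.module_hom class_ring V W"
    using car add smult by (auto simp: LinearCombinations.module_hom_def)
  then show ?thesis
    using V W by (simp add: linear_map_def mod_hom_def mod_hom_axioms_def vectorspace_def)
qed

lemma linear_functional_lincomb:
  fixes V :: "(complex, 'v, 'm) module_scheme"
  assumes V: "vectorspace class_ring V" and e: "linear_functional V e"
    and "finite A" "A \<subseteq> carrier V"
  shows "e (module.lincomb V a A) = (\<Sum>v\<in>A. a v * e v)"
proof -
  interpret V: vectorspace class_ring V by (rule V)
  have e0: "e \<zero>\<^bsub>V\<^esub> = 0"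
    using linear_functional_smult[OF e V.M.zero_closed, of 0] V.M.zero_closed V.lmult_0 by simp
  show ?thesis
    using assms(3,4)
  proof (induction A)
    case empty
    then show ?case by (simp add: V.lincomb_def e0)
  next
    case (insert v A)
    have "V.lincomb a (insert v A) = a v \<odot>\<^bsub>V\<^esub> v \<oplus>\<^bsub>V\<^esub> V.lincomb a A"
      using V.lincomb_insert[of A a v] insert by (simp add: Pi_def)
    moreover have "V.lincomb a A \<in> carrier V"
      using insert by (intro V.lincomb_closed) auto
    ultimately show ?case
      using insert V.smult_closed
      by (simp add: linear_functional_add[OF e] linear_functional_smult[OF e])
  qed
qed

text \<open>Induction on the set of functionals: a subspace is spanned by the kernel of one functional
  \<open>e x\<close> in it, on which the remaining functionals still separate points, and by at
  most one vector outside that kernel.\<close>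

lemma dim_le_card_separating_functionals:
  fixes V :: "(complex, 'v, 'm) module_scheme" and e :: "'x \<Rightarrow> 'v \<Rightarrow> complex"
  assumes V: "vectorspace class_ring V" and "finite X"
    and e: "\<And>x. x \<in> X \<Longrightarrow> linear_functional V (e x)"
    and sep: "\<And>v. v \<in> carrier V \<Longrightarrow> (\<And>x. x \<in> X \<Longrightarrow> e x v = 0) \<Longrightarrow> v = \<zero>\<^bsub>V\<^esub>"
  shows "vectorspace.fin_dim class_ring V \<and> cdim V \<le> card X"
proof -
  interpret V: vectorspace class_ring V by (rule V)
  have main: "\<exists>G. finite G \<and> G \<subseteq> carrier V \<and> card G \<le> card X \<and> W \<subseteq> V.span G"
    if "submodule class_ring W V" and "\<And>v. v \<in> W \<Longrightarrow> (\<And>x. x \<in> X \<Longrightarrow> e x v = 0) \<Longrightarrow> v = \<zero>\<^bsub>V\<^esub>" for W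
    using \<open>finite X\<close> e that
  proof (induction X arbitrary: W)
    case empty
    have "W \<subseteq> V.span {}"
      using empty V.span_is_submodule[of "{}"] by (auto simp: submodule_def)
    then show ?case by (intro exI[of _ "{}"]) auto
  next
    case (insert x X)
    interpret W: submodule class_ring W V by (rule insert.prems(2))
    let ?K = "{v \<in> W. e x v = 0}"
    have ex: "linear_functional V (e x)" using insert.prems by simp
    have e0: "e x \<zero>\<^bsub>V\<^esub> = 0"
      using linear_functional_smult[OF ex V.M.zero_closed, of 0] V.M.zero_closed V.lmult_0 by simp
    have K: "submodule class_ring ?K V"
      using W.subset linear_functional_add[OF ex] linear_functional_smult[OF ex]
      by unfold_locales (auto simp: subset_iff e0)
    have "\<exists>G. finite G \<and> G \<subseteq> carrier V \<and> card G \<le> card X \<and> ?K \<subseteq> V.span G"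
    proof (rule insert.IH[OF _ K])
      show "v = \<zero>\<^bsub>V\<^esub>" if "v \<in> ?K" "\<And>y. y \<in> X \<Longrightarrow> e y v = 0" for v
        using insert.prems(3)[of v] that by auto
    qed (use insert.prems in auto)
    then obtain G where G: "finite G" "G \<subseteq> carrier V" "card G \<le> card X" "?K \<subseteq> V.span G" by blast
    show ?case
    proof (cases "W = ?K")
      case True
      then show ?thesis using G insert.hyps by (intro exI[of _ G]) auto
    next
      case False
      then obtain u where u: "u \<in> W" "e x u \<noteq> 0" by auto
      have uV: "u \<in> carrier V" using u W.subset by auto
      have Gu: "insert u G \<subseteq> carrier V" using G uV by auto
      interpret S: submodule class_ring "V.span (insert u G)" V
        by (rule V.span_is_submodule[OF Gu])
      have uS: "u \<in> V.span (insert u G)" using V.in_own_span[OF Gu] by auto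
      have "W \<subseteq> V.span (insert u G)"
      proof
        fix v assume v: "v \<in> W"
        then have vV: "v \<in> carrier V" using W.subset by auto
        \<comment> \<open>split off the multiple of \<open>u\<close> on which \<open>e x\<close> takes the same value as on \<open>v\<close>\<close>
        define c where "c = e x v / e x u"
        define w where "w = v \<oplus>\<^bsub>V\<^esub> (- c) \<odot>\<^bsub>V\<^esub> u"
        have cu: "a \<odot>\<^bsub>V\<^esub> u \<in> carrier V" for a using uV by simp
        have "w \<in> W" unfolding w_def using v u by (intro W.m_closed W.smult_closed) auto
        moreover have "e x w = 0"
          unfolding w_def using vV uV cu u
          by (simp add: linear_functional_add[OF ex] linear_functional_smult[OF ex] c_def)
        ultimately have "w \<in> V.span G" using G by auto
        then have wS: "w \<in> V.span (insert u G)" using V.span_is_monotone[of G "insert u G"] by auto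
        have "(- c) \<odot>\<^bsub>V\<^esub> u \<oplus>\<^bsub>V\<^esub> c \<odot>\<^bsub>V\<^esub> u = \<zero>\<^bsub>V\<^esub>"
          using V.smult_l_distr[of "- c" c u] uV V.lmult_0[OF uV] by simp
        then have "w \<oplus>\<^bsub>V\<^esub> c \<odot>\<^bsub>V\<^esub> u = v"
          unfolding w_def using vV cu by (simp add: V.M.a_assoc)
        moreover have "w \<oplus>\<^bsub>V\<^esub> c \<odot>\<^bsub>V\<^esub> u \<in> V.span (insert u G)"
          using wS uS by (intro S.m_closed S.smult_closed) auto
        ultimately show "v \<in> V.span (insert u G)" by simp
      qed
      moreover have "card (insert u G) \<le> card (insert x X)"
        using G insert.hyps by (simp add: card_insert_if)
      ultimately show ?thesis using G Gu by (intro exI[of _ "insert u G"]) auto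
    qed
  qed
  have "submodule class_ring (carrier V) V"
    by unfold_locales auto
  from main[OF this sep] obtain G where
    G: "finite G" "G \<subseteq> carrier V" "card G \<le> card X" "carrier V \<subseteq> V.span G"
    by auto
  then have "V.gen_set G" using V.span_is_subset2[of G] by auto
  then show ?thesis
    using G V.gen_ge_dim[of G] unfolding V.fin_dim_def by (meson le_trans)
qed

text \<open>Functionals vanishing on the kernel of a surjection descend to its image, where a family of
  vectors with a dual family of functionals is independent.\<close>

lemma card_le_dim_of_dual_family:
  fixes V :: "(complex, 'v, 'm) module_scheme" and W :: "(complex, 'w, 'k) module_scheme"
    and e :: "'j \<Rightarrow> 'v \<Rightarrow> complex"
  assumes f: "linear_map class_ring V W f" and fin: "vectorspace.fin_dim class_ring V"
    and surj: "f ` carrier V = carrier W"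
    and "finite J" and u: "\<And>j. j \<in> J \<Longrightarrow> u j \<in> carrier V"
    and e: "\<And>j. j \<in> J \<Longrightarrow> linear_functional V (e j)"
    and dual: "\<And>i j. i \<in> J \<Longrightarrow> j \<in> J \<Longrightarrow> e i (u j) = (if i = j then 1 else 0)"
    and ker: "\<And>j v. j \<in> J \<Longrightarrow> v \<in> carrier V \<Longrightarrow> f v = \<zero>\<^bsub>W\<^esub> \<Longrightarrow> e j v = 0"
  shows "card J \<le> cdim W"
proof -
  interpret V: vectorspace class_ring V using f by (simp add: linear_map_def)
  interpret W: vectorspace class_ring W using f by (simp add: linear_map_def)
  interpret f: linear_map class_ring V W f by (rule f)
  define g where "g j w = e j (inv_into (carrier V) f w)" for j w
  have inv: "inv_into (carrier V) f w \<in> carrier V" "f (inv_into (carrier V) f w) = w"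
    if "w \<in> carrier W" for w
    using that surj by (auto intro: inv_into_into f_inv_into_f)
  have e_eq: "e j v = e j v'" if "j \<in> J" "v \<in> carrier V" "v' \<in> carrier V" "f v = f v'" for j v v'
  proof -
    have m: "(- 1) \<odot>\<^bsub>V\<^esub> v' \<in> carrier V" using that by simp
    have "f v \<oplus>\<^bsub>W\<^esub> (- 1) \<odot>\<^bsub>W\<^esub> f v = \<zero>\<^bsub>W\<^esub>"
      using W.smult_l_distr[of 1 "- 1" "f v"] W.lmult_0[of "f v"] W.smult_one[of "f v"] that by simp
    then have "f (v \<oplus>\<^bsub>V\<^esub> (- 1) \<odot>\<^bsub>V\<^esub> v') = \<zero>\<^bsub>W\<^esub>"
      using that m by simp
    then have "e j (v \<oplus>\<^bsub>V\<^esub> (- 1) \<odot>\<^bsub>V\<^esub> v') = 0"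
      using ker that m by simp
    then show ?thesis
      using that m by (simp add: linear_functional_add[OF e] linear_functional_smult[OF e])
  qed
  have g_f: "g j (f v) = e j v" if "j \<in> J" "v \<in> carrier V" for j v
    unfolding g_def using inv[OF f.f_im[OF that(2)]] by (intro e_eq that)
  have g: "linear_functional W (g j)" if "j \<in> J" for j
    unfolding linear_functional_def
  proof (intro conjI ballI allI)
    fix w assume "w \<in> carrier W"
    then obtain v where v: "v \<in> carrier V" "w = f v" using surj by blast
    show "g j (c \<odot>\<^bsub>W\<^esub> w) = c * g j w" for c
      using g_f[OF that, of "c \<odot>\<^bsub>V\<^esub> v"] g_f[OF that, of v] v
      by (simp add: linear_functional_smult[OF e[OF that]])
    fix w' assume "w' \<in> carrier W"
    then obtain v' where v': "v' \<in> carrier V" "w' = f v'" using surj by blast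
    show "g j (w \<oplus>\<^bsub>W\<^esub> w') = g j w + g j w'"
      using g_f[OF that, of "v \<oplus>\<^bsub>V\<^esub> v'"] g_f[OF that, of v] g_f[OF that, of v'] v v'
      by (simp add: linear_functional_add[OF e[OF that]])
  qed
  have dual_g: "g i (f (u j)) = (if i = j then 1 else 0)" if "i \<in> J" "j \<in> J" for i j
    using that by (simp add: g_f u dual)
  have inj: "inj_on (\<lambda>j. f (u j)) J"
  proof
    fix i j assume "i \<in> J" "j \<in> J" "f (u i) = f (u j)"
    then show "i = j" using dual_g[of i i] dual_g[of i j] by (auto split: if_splits)
  qed
  let ?A = "(\<lambda>j. f (u j)) ` J"
  have A: "finite ?A" "?A \<subseteq> carrier W" using \<open>finite J\<close> u by auto
  have "W.lin_indpt ?A"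
  proof (rule W.finite_lin_indpt2[OF A])
    fix a assume a: "W.lincomb a ?A = \<zero>\<^bsub>W\<^esub>"
    show "\<forall>w\<in>?A. a w = \<zero>\<^bsub>class_ring\<^esub>"
    proof
      fix w assume "w \<in> ?A"
      then obtain i where i: "i \<in> J" "w = f (u i)" by auto
      have "g i \<zero>\<^bsub>W\<^esub> = 0"
        using linear_functional_smult[OF g[OF i(1)] W.M.zero_closed, of 0] W.lmult_0 by simp
      then have "0 = (\<Sum>w\<in>?A. a w * g i w)"
        using linear_functional_lincomb[OF W.vectorspace_axioms g[OF i(1)] A, of a] a by simp
      also have "\<dots> = (\<Sum>j\<in>J. a (f (u j)) * g i (f (u j)))"
        by (simp add: sum.reindex[OF inj])
      also have "\<dots> = (\<Sum>j\<in>J. if i = j then a (f (u j)) else 0)"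
        using i by (intro sum.cong) (auto simp: dual_g)
      also have "\<dots> = a w" using i \<open>finite J\<close> by simp
      finally show "a w = \<zero>\<^bsub>class_ring\<^esub>" by simp
    qed
  qed
  then have "card ?A \<le> cdim W"
    using f.rank_nullity_main(2)[OF fin surj] A by (intro W.li_le_dim(2)) auto
  then show ?thesis by (simp add: card_image[OF inj])
qed

section \<open>The differential of an alternating cochain\<close>

locale alternating_algebra =
  fixes L :: "'a lie_algebra"
  assumes vs: "vectorspace class_ring L"
    and bracket_closed: "\<And>x y. x \<in> carrier L \<Longrightarrow> y \<in> carrier L \<Longrightarrow> bracket L x y \<in> carrier L"
    and bracket_add_left: "\<And>x y z. x \<in> carrier L \<Longrightarrow> y \<in> carrier L \<Longrightarrow> z \<in> carrier L \<Longrightarrow>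
      bracket L (x \<oplus>\<^bsub>L\<^esub> y) z = bracket L x z \<oplus>\<^bsub>L\<^esub> bracket L y z"
    and bracket_add_right: "\<And>x y z. x \<in> carrier L \<Longrightarrow> y \<in> carrier L \<Longrightarrow> z \<in> carrier L \<Longrightarrow>
      bracket L z (x \<oplus>\<^bsub>L\<^esub> y) = bracket L z x \<oplus>\<^bsub>L\<^esub> bracket L z y"
    and bracket_smult_left: "\<And>c x z. x \<in> carrier L \<Longrightarrow> z \<in> carrier L \<Longrightarrow>
      bracket L (c \<odot>\<^bsub>L\<^esub> x) z = c \<odot>\<^bsub>L\<^esub> bracket L x z"
    and bracket_smult_right: "\<And>c x z. x \<in> carrier L \<Longrightarrow> z \<in> carrier L \<Longrightarrow>
      bracket L z (c \<odot>\<^bsub>L\<^esub> x) = c \<odot>\<^bsub>L\<^esub> bracket L z x"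
    and bracket_self: "\<And>x. x \<in> carrier L \<Longrightarrow> bracket L x x = \<zero>\<^bsub>L\<^esub>"
begin

sublocale L: vectorspace class_ring L by (rule vs)

end

definition multilinear :: "'a lie_algebra \<Rightarrow> nat \<Rightarrow> ('a list \<Rightarrow> complex) \<Rightarrow> bool" where
  "multilinear L p f \<longleftrightarrow>
     (\<forall>xs \<in> tuples L p. \<forall>i < p. \<forall>x \<in> carrier L. \<forall>y \<in> carrier L.
        f (xs[i := x \<oplus>\<^bsub>L\<^esub> y]) = f (xs[i := x]) + f (xs[i := y])) \<and>
     (\<forall>xs \<in> tuples L p. \<forall>i < p. \<forall>c. \<forall>x \<in> carrier L. f (xs[i := c \<odot>\<^bsub>L\<^esub> x]) = c * f (xs[i := x]))"

lemma multilinear_add: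
  "multilinear L p f \<Longrightarrow> xs \<in> tuples L p \<Longrightarrow> i < p \<Longrightarrow> x \<in> carrier L \<Longrightarrow> y \<in> carrier L \<Longrightarrow>
     f (xs[i := x \<oplus>\<^bsub>L\<^esub> y]) = f (xs[i := x]) + f (xs[i := y])"
  by (simp add: multilinear_def)

lemma multilinear_smult:
  "multilinear L p f \<Longrightarrow> xs \<in> tuples L p \<Longrightarrow> i < p \<Longrightarrow> x \<in> carrier L \<Longrightarrow>
     f (xs[i := c \<odot>\<^bsub>L\<^esub> x]) = c * f (xs[i := x])"
  by (simp add: multilinear_def)

lemma cochains_iff:
  "f \<in> cochains L p \<longleftrightarrow>
     (\<forall>xs. xs \<notin> tuples L p \<longrightarrow> f xs = 0) \<and> multilinear L p f \<and>
     (\<forall>xs \<in> tuples L p. \<forall>i < p. \<forall>j < p. i \<noteq> j \<and> xs ! i = xs ! j \<longrightarrow> f xs = 0)"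
  by (auto simp: cochains_def multilinear_def)

lemma cochain_alternating:
  "f \<in> cochains L p \<Longrightarrow> xs \<in> tuples L p \<Longrightarrow> \<not> distinct xs \<Longrightarrow> f xs = 0"
  unfolding cochains_iff distinct_conv_nth by (auto simp: tuples_def)

lemma tuples_update: "xs \<in> tuples L p \<Longrightarrow> x \<in> carrier L \<Longrightarrow> xs[i := x] \<in> tuples L p"
  using set_update_subset_insert[of xs i x] by (auto simp: tuples_def)

lemma tuples_nth: "xs \<in> tuples L p \<Longrightarrow> i < p \<Longrightarrow> xs ! i \<in> carrier L"
  by (auto simp: tuples_def)

lemma nths_delete_two:
  assumes "i < j" "j < length xs"
  shows "nths xs (- {i, j}) = take i xs @ drop (Suc i) (take j xs) @ drop (Suc j) xs"
proof -
  let ?A = "take i xs" and ?B = "drop (Suc i) (take j xs)" and ?C = "drop (Suc j) xs"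
  have split_j: "xs = take j xs @ xs ! j # ?C" using assms by (intro id_take_nth_drop)
  have split_i: "take j xs = ?A @ xs ! i # ?B"
    using id_take_nth_drop[of i "take j xs"] assms by simp
  have "xs = (?A @ xs ! i # ?B) @ xs ! j # ?C"
    by (rule trans[OF split_j]) (rule arg_cong[OF split_i])
  then have "nths xs (- {i, j}) = nths ((?A @ xs ! i # ?B) @ xs ! j # ?C) (- {i, j})" by (rule arg_cong)
  also have "\<dots> = nths ?A (- {i, j}) @ nths [xs ! i] {k. k + i \<in> - {i, j}} @ 
      nths ?B {k. k + Suc i \<in> - {i, j}} @ nths [xs ! j] {k. k + j \<in> - {i, j}} @ nths ?C {k. k + Suc j \<in> - {i, j}}"
    using assms by (simp add: nths_append nths_Cons add.commute add.left_commute)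
  also have "nths ?A (- {i, j}) = ?A" using assms by (intro nths_all) auto
  also have "nths ?B {k. k + Suc i \<in> - {i, j}} = ?B" using assms by (intro nths_all) auto
  also have "nths ?C {k. k + Suc j \<in> - {i, j}} = ?C" using assms by (intro nths_all) auto
  finally show ?thesis by simp
qed

context alternating_algebra
begin

definition term_args :: "'a list \<Rightarrow> nat \<Rightarrow> nat \<Rightarrow> 'a list" where
  "term_args xs i j = bracket L (xs ! i) (xs ! j) # nths xs (- {i, j})"

lemma term_args_tuples:
  assumes "xs \<in> tuples L (Suc p)" "i < j" "j \<le> p"
  shows "term_args xs i j \<in> tuples L p"
proof -
  have "set (nths xs (- {i, j})) \<subseteq> carrier L"
    using set_nths_subset assms(1) by (fastforce simp: tuples_def)
  moreover have "length (nths xs (- {i, j})) = p - 1"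
    using assms by (subst nths_delete_two) (auto simp: tuples_def)
  ultimately show ?thesis
    using assms tuples_nth[OF assms(1)] by (auto simp: term_args_def tuples_def intro!: bracket_closed)
qed

text \<open>Changing one entry of the tuple changes exactly one argument of each term of the differential.\<close>

lemma term_args_update:
  assumes "xs \<in> tuples L (Suc p)" "i < j" "j \<le> p" "l \<le> p"
  obtains k B where "k < p" "\<And>x. term_args (xs[l := x]) i j = (term_args xs i j)[k := B x]"
    and "B = (\<lambda>x. x) \<or> (\<exists>z \<in> carrier L. B = (\<lambda>x. bracket L x z)) \<or> (\<exists>z \<in> carrier L. B = (\<lambda>x. bracket L z x))"
proof -
  have len: "length xs = Suc p" using assms by (simp add: tuples_def)
  have nths: "nths ys (- {i, j}) = take i ys @ drop (Suc i) (take j ys) @ drop (Suc j) ys"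
    if "length ys = Suc p" for ys :: "'a list"
    using that assms by (intro nths_delete_two) auto
  consider "l = i" | "l = j" | "l < i" | "i < l" "l < j" | "j < l" by linarith
  then show ?thesis
  proof cases
    case 1
    have "term_args (xs[l := x]) i j = (term_args xs i j)[0 := bracket L x (xs ! j)]" for x
      using 1 assms len by (simp add: term_args_def nths take_update_swap drop_update_swap list_update_beyond)
    moreover have "xs ! j \<in> carrier L" using assms tuples_nth[OF assms(1)] by auto
    ultimately show ?thesis using assms by (intro that[of 0 "\<lambda>x. bracket L x (xs ! j)"]) auto
  next
    case 2
    have "term_args (xs[l := x]) i j = (term_args xs i j)[0 := bracket L (xs ! i) x]" for x
      using 2 assms len by (simp add: term_args_def nths take_update_swap drop_update_swap list_update_beyond)
    moreover have "xs ! i \<in> carrier L" using assms tuples_nth[OF assms(1)] by auto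
    ultimately show ?thesis using assms by (intro that[of 0 "\<lambda>x. bracket L (xs ! i) x"]) auto
  next
    case 3
    have "term_args (xs[l := x]) i j = (term_args xs i j)[Suc l := x]" for x
      using 3 assms len
      by (simp add: term_args_def nths take_update_swap drop_update_swap list_update_beyond list_update_append)
    then show ?thesis using 3 assms by (intro that[of "Suc l" "\<lambda>x. x"]) auto
  next
    case 4
    have "term_args (xs[l := x]) i j = (term_args xs i j)[l := x]" for x
      using 4 assms len
      by (cases l) (simp_all add: term_args_def nths take_update_swap drop_update_swap list_update_beyond list_update_append)
    then show ?thesis using 4 assms by (intro that[of l "\<lambda>x. x"]) auto
  next
    case 5
    obtain r m where rm: "j = Suc (i + r)" "l = Suc (j + m)"
      using 5 assms less_imp_Suc_add by (metis add.commute)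
    have "term_args (xs[l := x]) i j = (term_args xs i j)[l - 1 := x]" for x
      using len assms(4) rm(2)
      by (simp only: term_args_def nths length_list_update list_update_code nth_list_update)
        (simp add: rm(1) take_update_swap drop_update_swap list_update_beyond list_update_append)
    then show ?thesis using 5 assms by (intro that[of "l - 1" "\<lambda>x. x"]) auto
  qed
qed

lemma multilinear_ce_diff:
  assumes f: "f \<in> cochains L p"
  shows "multilinear L (Suc p) (ce_diff L p f)"
proof -
  have ml: "multilinear L p f" using f by (simp add: cochains_iff)
  have add: "f (term_args (xs[l := x \<oplus>\<^bsub>L\<^esub> y]) i j)
      = f (term_args (xs[l := x]) i j) + f (term_args (xs[l := y]) i j)"
    and smult: "f (term_args (xs[l := c \<odot>\<^bsub>L\<^esub> x]) i j) = c * f (term_args (xs[l := x]) i j)"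
    if A: "xs \<in> tuples L (Suc p)" "i < j" "j \<le> p" "l \<le> p" and xy: "x \<in> carrier L" "y \<in> carrier L"
    for xs i j l x y c
  proof -
    obtain k B where k: "k < p" and eq: "\<And>x. term_args (xs[l := x]) i j = (term_args xs i j)[k := B x]"
      and B: "B = (\<lambda>x. x) \<or> (\<exists>z \<in> carrier L. B = (\<lambda>x. bracket L x z)) \<or>
        (\<exists>z \<in> carrier L. B = (\<lambda>x. bracket L z x))"
      by (rule term_args_update[OF A]) (rule that, assumption+)
    have "B (x \<oplus>\<^bsub>L\<^esub> y) = B x \<oplus>\<^bsub>L\<^esub> B y" "B (c \<odot>\<^bsub>L\<^esub> x) = c \<odot>\<^bsub>L\<^esub> B x"
      "B x \<in> carrier L" "B y \<in> carrier L"
      using B xy by (auto simp: bracket_add_left bracket_add_right bracket_smult_left bracket_smult_right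
          bracket_closed)
    then show "f (term_args (xs[l := x \<oplus>\<^bsub>L\<^esub> y]) i j)
      = f (term_args (xs[l := x]) i j) + f (term_args (xs[l := y]) i j)"
      "f (term_args (xs[l := c \<odot>\<^bsub>L\<^esub> x]) i j) = c * f (term_args (xs[l := x]) i j)"
      unfolding eq using term_args_tuples[OF A(1-3)] k
      by (simp_all add: multilinear_add[OF ml] multilinear_smult[OF ml])
  qed
  have diff: "ce_diff L p f ys = (\<Sum>(i, j) \<in> {(i, j). i < j \<and> j \<le> p}. (-1) ^ (i + j) * f (term_args ys i j))"
    if "ys \<in> tuples L (Suc p)" for ys
    using that by (simp add: ce_diff_def term_args_def)
  show ?thesis
    unfolding multilinear_def
  proof (intro conjI ballI allI impI)
    fix xs l x assume A: "xs \<in> tuples L (Suc p)" "l < Suc p" "x \<in> carrier L"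
    have cx: "c \<odot>\<^bsub>L\<^esub> x \<in> carrier L" for c using A by simp
    show "ce_diff L p f (xs[l := c \<odot>\<^bsub>L\<^esub> x]) = c * ce_diff L p f (xs[l := x])" for c
      unfolding diff[OF tuples_update[OF A(1,3)]] diff[OF tuples_update[OF A(1) cx]] sum_distrib_left
      using A by (intro sum.cong refl) (clarsimp simp: smult)
    fix y assume y: "y \<in> carrier L"
    have xy: "x \<oplus>\<^bsub>L\<^esub> y \<in> carrier L" using A y by simp
    show "ce_diff L p f (xs[l := x \<oplus>\<^bsub>L\<^esub> y]) = ce_diff L p f (xs[l := x]) + ce_diff L p f (xs[l := y])"
      unfolding diff[OF tuples_update[OF A(1,3)]] diff[OF tuples_update[OF A(1) y]]
        diff[OF tuples_update[OF A(1) xy]] sum.distrib[symmetric]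
      using A y by (intro sum.cong refl) (clarsimp simp: add distrib_left)
  qed
qed

text \<open>When two adjacent entries agree, the terms with exactly one of them in the bracket cancel in
  pairs: exchanging the two positions preserves the arguments and flips the sign. The other terms
  vanish, because they contain either \<open>[x, x]\<close> or a repeated argument.\<close>

lemma ce_diff_adjacent_eq:
  assumes f: "f \<in> cochains L p" and xs: "xs \<in> tuples L (Suc p)"
    and u: "u < p" and eq: "xs ! u = xs ! Suc u"
  shows "ce_diff L p f xs = 0"
proof -
  have len: "length xs = Suc p" using xs by (simp add: tuples_def)
  let ?P = "{(i, j). i < j \<and> j \<le> p}"
  define F where "F = (\<lambda>(i, j). (-1) ^ (i + j) * f (term_args xs i j) :: complex)"
  define s where "s i = (if i = u then Suc u else if i = Suc u then u else i)" for i
  define t where "t = (\<lambda>(i, j). if (i, j) = (u, Suc u) then (i, j) else (s i, s j))"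
  have fin: "finite ?P" by (rule finite_subset[of _ "{..p} \<times> {..p}"]) auto
  have ss: "s (s i) = i" for i by (auto simp: s_def)
  have t_in: "t z \<in> ?P" if "z \<in> ?P" for z
    using that u by (auto simp: t_def s_def split: if_splits)
  have tt: "t (t z) = z" if z: "z \<in> ?P" for z
  proof -
    obtain i j where ij: "z = (i, j)" "i < j" using z by auto
    have "i = Suc u \<and> j = u" if "s i = u" "s j = Suc u"
      using that ss[of i] ss[of j] by (auto simp: s_def)
    then show ?thesis using ij by (auto simp: t_def ss)
  qed
  have F_t: "F (t z) = - F z" if z: "z \<in> ?P" for z
  proof -
    obtain i j where ij: "z = (i, j)" "i < j" "j \<le> p" using z by auto
    have nths: "nths xs (- {a, b}) = take a xs @ drop (Suc a) (take b xs) @ drop (Suc b) xs"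
      if "a < b" "b \<le> p" for a b
      using that len by (intro nths_delete_two) auto
    have take_u: "take (Suc u) xs = take u xs @ [xs ! u]" and drop_u: "drop (Suc u) xs = xs ! u # drop (Suc (Suc u)) xs"
      using u len eq by (simp_all add: take_Suc_conv_app_nth Cons_nth_drop_Suc)
    consider "i = u" "j = Suc u" | "i \<noteq> u" "i \<noteq> Suc u" "j \<noteq> u" "j \<noteq> Suc u"
      | "i < u" "j = u" | "i < u" "j = Suc u" | "i = u" "Suc u < j" | "i = Suc u" "Suc u < j"
      using ij by linarith
    then show ?thesis
    proof cases
      case 1
      have "term_args xs i j \<in> tuples L p" using term_args_tuples[OF xs] ij by simp
      moreover have "term_args xs i j = (term_args xs i j)[0 := 0 \<odot>\<^bsub>L\<^esub> \<zero>\<^bsub>L\<^esub>]"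
        using 1 eq tuples_nth[OF xs, of "Suc u"] u bracket_self by (simp add: term_args_def L.lmult_0)
      moreover have "multilinear L p f" using f by (simp add: cochains_iff)
      ultimately have "f (term_args xs i j) = 0"
        using multilinear_smult[of L p f "term_args xs i j" 0 "\<zero>\<^bsub>L\<^esub>" 0] u L.M.zero_closed by simp
      then show ?thesis using 1 ij by (simp add: t_def F_def)
    next
      case 2
      have twice: "\<not> distinct ys" if "Suc k < length ys" "ys ! k = ys ! Suc k" for ys :: "'a list" and k
        using that nth_eq_iff_index_eq[of ys k "Suc k"] by auto
      consider "Suc u < i" | "i < u" "Suc u < j" | "j < u" using 2 ij by linarith
      then have "\<not> distinct (nths xs (- {i, j}))"
      proof cases
        case 1
        then have "\<not> distinct (take i xs)" using ij len eq by (intro twice[of u]) auto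
        then show ?thesis using ij by (simp add: nths)
      next
        case 2
        then have "\<not> distinct (drop (Suc i) (take j xs))"
          using ij len eq by (intro twice[of "u - Suc i"]) auto
        then show ?thesis using ij by (simp add: nths)
      next
        case 3
        then have "\<not> distinct (drop (Suc j) xs)"
          using ij len eq u by (intro twice[of "u - Suc j"]) auto
        then show ?thesis using ij by (simp add: nths)
      qed
      then have "f (term_args xs i j) = 0"
        using cochain_alternating[OF f term_args_tuples[OF xs ij(2,3)]] by (simp add: term_args_def)
      then show ?thesis using 2 ij by (simp add: t_def F_def s_def)
    next
      case 3
      then have "term_args xs i j = term_args xs i (Suc u)"
        using u ij eq len by (simp add: term_args_def nths take_u drop_u)
      then show ?thesis using 3 ij by (simp add: t_def F_def s_def)
    next
      case 4
      then have "term_args xs i j = term_args xs i u"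
        using u ij eq len by (simp add: term_args_def nths take_u drop_u)
      then show ?thesis using 4 ij by (simp add: t_def F_def s_def)
    next
      case 5
      then have "term_args xs i j = term_args xs (Suc u) j"
        using u ij eq len by (simp add: term_args_def nths take_u drop_u drop_take take_Cons')
      then show ?thesis using 5 ij by (simp add: t_def F_def s_def)
    next
      case 6
      then have "term_args xs i j = term_args xs u j"
        using u ij eq len by (simp add: term_args_def nths take_u drop_u drop_take take_Cons')
      then show ?thesis using 6 ij by (simp add: t_def F_def s_def)
    qed
  qed
  have "sum F ?P = sum (F \<circ> t) ?P"
    by (rule sum.reindex_bij_witness[of _ t t]) (auto simp del: mem_Collect_eq split_paired_All simp: t_in tt)
  also have "\<dots> = - sum F ?P" using F_t by (simp add: sum_negf)
  finally have "sum F ?P = 0" by simp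
  then show ?thesis
    using xs by (simp add: ce_diff_def F_def term_args_def)
qed

end

text \<open>The polarization argument: expand the vanishing value at \<open>x + y, x + y\<close> in the two
  adjacent slots.\<close>

lemma multilinear_swap:
  assumes vs: "vectorspace class_ring L" and g: "multilinear L m g"
    and adj: "\<And>xs u. xs \<in> tuples L m \<Longrightarrow> Suc u < m \<Longrightarrow> xs ! u = xs ! Suc u \<Longrightarrow> g xs = 0"
    and xs: "xs \<in> tuples L m" and u: "Suc u < m"
  shows "g (xs[u := xs ! Suc u, Suc u := xs ! u]) = - g xs"
proof -
  interpret L: vectorspace class_ring L by (rule vs)
  have len: "length xs = m" using xs by (simp add: tuples_def)
  define h where "h a b = g (xs[u := a, Suc u := b])" for a b
  have diag: "h a a = 0" if "a \<in> carrier L" for a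
    unfolding h_def using that xs u len by (intro adj[of _ u] tuples_update) auto
  have right: "h a (b \<oplus>\<^bsub>L\<^esub> c) = h a b + h a c"
    if "a \<in> carrier L" "b \<in> carrier L" "c \<in> carrier L" for a b c
    unfolding h_def using that u by (intro multilinear_add[OF g tuples_update[OF xs]])
  have left: "h (b \<oplus>\<^bsub>L\<^esub> c) a = h b a + h c a"
    if "a \<in> carrier L" "b \<in> carrier L" "c \<in> carrier L" for a b c
    unfolding h_def list_update_swap[OF n_not_Suc_n, of xs u]
    using that u by (intro multilinear_add[OF g tuples_update[OF xs]]) auto
  let ?x = "xs ! u" and ?y = "xs ! Suc u"
  have xy: "?x \<in> carrier L" "?y \<in> carrier L" using tuples_nth[OF xs] u by auto
  then have "h (?x \<oplus>\<^bsub>L\<^esub> ?y) (?x \<oplus>\<^bsub>L\<^esub> ?y) = h ?x ?y + h ?y ?x"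
    by (simp add: left right diag[OF xy(1)] diag[OF xy(2)])
  moreover have "h (?x \<oplus>\<^bsub>L\<^esub> ?y) (?x \<oplus>\<^bsub>L\<^esub> ?y) = 0" using xy by (intro diag) simp
  ultimately have "h ?y ?x = - h ?x ?y" by (simp add: eq_neg_iff_add_eq_0 add.commute)
  then show ?thesis by (simp add: h_def list_update_id)
qed

text \<open>Two equal entries can be made adjacent by transpositions, each of which only changes the sign.\<close>

lemma multilinear_alternating_of_adjacent:
  assumes vs: "vectorspace class_ring L" and g: "multilinear L m g"
    and adj: "\<And>xs u. xs \<in> tuples L m \<Longrightarrow> Suc u < m \<Longrightarrow> xs ! u = xs ! Suc u \<Longrightarrow> g xs = 0"
    and xs: "xs \<in> tuples L m" and nd: "\<not> distinct xs"
  shows "g xs = 0"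
proof -
  have *: "g xs = 0"
    if "xs \<in> tuples L m" "Suc (u + n) < m" "xs ! u = xs ! Suc (u + n)" for n u xs
    using that
  proof (induction n arbitrary: xs)
    case 0
    then show ?case using adj[of xs u] by simp
  next
    case (Suc n)
    \<comment> \<open>move the second of the two equal entries one step to the left\<close>
    let ?v = "Suc (u + n)"
    let ?ys = "xs[?v := xs ! Suc ?v, Suc ?v := xs ! ?v]"
    have len: "length xs = m" using Suc.prems by (simp add: tuples_def)
    have "?ys \<in> tuples L m"
      using Suc.prems by (intro tuples_update) (auto intro: tuples_nth)
    then have "g ?ys = 0" using Suc.prems len by (intro Suc.IH) auto
    then show ?case
      using multilinear_swap[OF vs g adj Suc.prems(1), where u = ?v] Suc.prems by simp
  qed
  obtain u v where "u < v" "v < m" "xs ! u = xs ! v"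
    using nd xs unfolding distinct_conv_nth tuples_def by (auto simp: nat_neq_iff)
  then show ?thesis using *[OF xs, of u "v - Suc u"] by simp
qed

text \<open>The linear span as a closure, which gives an induction principle for the elements of an algebra in
  terms of a basis.\<close>

inductive_set lin_span :: "'a lie_algebra \<Rightarrow> 'a set \<Rightarrow> 'a set"
  for A :: "'a lie_algebra" and G :: "'a set" where
  gen: "x \<in> G \<Longrightarrow> x \<in> lin_span A G"
| zero: "\<zero>\<^bsub>A\<^esub> \<in> lin_span A G"
| add: "x \<in> lin_span A G \<Longrightarrow> y \<in> lin_span A G \<Longrightarrow> x \<oplus>\<^bsub>A\<^esub> y \<in> lin_span A G"
| smult: "x \<in> lin_span A G \<Longrightarrow> c \<odot>\<^bsub>A\<^esub> x \<in> lin_span A G"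

text \<open>A multilinear form is determined by its values at tuples of generators. The entries are replaced
  by generators one position at a time, from the last position to the first.\<close>

lemma multilinear_eq_0_if_spanning:
  assumes vs: "vectorspace class_ring L" and f: "multilinear L p f"
    and G: "G \<subseteq> carrier L" and span: "carrier L \<subseteq> lin_span L G"
    and zero: "\<And>xs. length xs = p \<Longrightarrow> set xs \<subseteq> G \<Longrightarrow> f xs = 0"
    and xs: "xs \<in> tuples L p"
  shows "f xs = 0"
proof -
  interpret L: vectorspace class_ring L by (rule vs)
  have sub: "x \<in> carrier L" if "x \<in> lin_span L G" for x
    using that G by induction auto
  have "f xs = 0" if "q \<le> p" "xs \<in> tuples L p" "set (drop q xs) \<subseteq> G" for q xs
    using that
  proof (induction q arbitrary: xs)
    case 0
    then show ?case using zero by (simp add: tuples_def)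
  next
    case (Suc q)
    have len: "length xs = p" using Suc.prems by (simp add: tuples_def)
    have "xs ! q \<in> lin_span L G" using tuples_nth[OF Suc.prems(2), of q] Suc.prems(1) span by auto
    then have "f (xs[q := xs ! q]) = 0"
    proof induction
      case (gen x)
      then show ?case
        using Suc.prems len G
        by (intro Suc.IH tuples_update) (auto simp: drop_update_swap simp flip: Cons_nth_drop_Suc)
    next
      case zero
      then show ?case
        using multilinear_smult[OF f Suc.prems(2), of q "\<zero>\<^bsub>L\<^esub>" 0] L.lmult_0[of "\<zero>\<^bsub>L\<^esub>"] Suc.prems(1)
        by simp
    next
      case (add x y)
      then show ?case using multilinear_add[OF f Suc.prems(2), of q x y] sub Suc.prems(1) by simp
    next
      case (smult x c)
      then show ?case using multilinear_smult[OF f Suc.prems(2), of q x c] sub Suc.prems(1) by simp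
    qed
    then show ?case by simp
  qed
  from this[of p xs] show ?thesis using xs by (simp add: tuples_def)
qed

section \<open>Volume forms on coordinate subspaces\<close>

text \<open>An algebra with a finite basis \<open>b\<close> and the dual coordinate functionals
  \<open>\<xi>\<close>.\<close>

locale based_alternating_algebra = alternating_algebra L for L :: "'a lie_algebra" +
  fixes I :: "'i set" and b :: "'i \<Rightarrow> 'a" and \<xi> :: "'i \<Rightarrow> 'a \<Rightarrow> complex"
  assumes finite_I: "finite I"
    and b_carrier: "\<And>i. i \<in> I \<Longrightarrow> b i \<in> carrier L"
    and spanning: "carrier L \<subseteq> lin_span L (b ` I)"
    and \<xi>_linear: "\<And>i. i \<in> I \<Longrightarrow> linear_functional L (\<xi> i)"
    and \<xi>_b: "\<And>i j. i \<in> I \<Longrightarrow> j \<in> I \<Longrightarrow> \<xi> i (b j) = (if i = j then 1 else 0)"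
begin

definition volume_matrix :: "'i list \<Rightarrow> 'a list \<Rightarrow> complex mat" where
  "volume_matrix us xs = mat (length us) (length us) (\<lambda>(r, c). \<xi> (us ! c) (xs ! r))"

text \<open>For a list \<open>us\<close> of basis indices this is the wedge product of the coordinates
  \<open>\<xi> u\<close> in the order of the list: the volume form of the subspace spanned by the
  \<open>b u\<close>, extended along the complementary coordinate subspace.\<close>

definition volume_form :: "'i list \<Rightarrow> 'a list \<Rightarrow> complex" where
  "volume_form us xs = (if xs \<in> tuples L (length us) then det (volume_matrix us xs) else 0)"

lemma volume_matrix_carrier: "volume_matrix us xs \<in> carrier_mat (length us) (length us)"
  by (simp add: volume_matrix_def)

text \<open>The Leibniz expansion exposes each argument in exactly one factor of each product; the
  multilinearity of the volume form and its vanishing on a zero row or column are read off from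
  it.\<close>

lemma det_volume_matrix:
  "det (volume_matrix us xs) =
    (\<Sum>p | p permutes {0..<length us}. signof p * (\<Prod>i = 0..<length us. \<xi> (us ! p i) (xs ! i)))"
  unfolding det_def'[OF volume_matrix_carrier]
proof (intro sum.cong refl arg_cong2[where f = "(*)"] prod.cong)
  fix p i assume "p \<in> {p. p permutes {0..<length us}}" "i \<in> {0..<length us}"
  then show "volume_matrix us xs $$ (i, p i) = \<xi> (us ! p i) (xs ! i)"
    using permutes_in_image[of p "{0..<length us}" i] by (auto simp: volume_matrix_def)
qed

lemma volume_form_cochain:
  assumes us: "set us \<subseteq> I"
  shows "volume_form us \<in> cochains L (length us)"
proof -
  let ?p = "length us"
  have expand: "volume_form us (xs[i := x]) = (\<Sum>p | p permutes {0..<?p}.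
      signof p * (\<xi> (us ! p i) x * (\<Prod>k\<in>{0..<?p} - {i}. \<xi> (us ! p k) (xs ! k))))"
    if "xs \<in> tuples L ?p" "i < ?p" "x \<in> carrier L" for xs i x
  proof -
    have "(\<Prod>k = 0..<?p. \<xi> (us ! p k) (xs[i := x] ! k))
        = \<xi> (us ! p i) x * (\<Prod>k\<in>{0..<?p} - {i}. \<xi> (us ! p k) (xs ! k))" for p
      using that by (subst prod.remove[of _ i]) (auto simp: tuples_def intro!: prod.cong)
    then show ?thesis
      using that by (simp add: volume_form_def tuples_update det_volume_matrix)
  qed
  have lin: "linear_functional L (\<xi> (us ! p i))" if "p permutes {0..<?p}" "i < ?p" for p i
    using that permutes_in_image[of p "{0..<?p}" i] us by (intro \<xi>_linear) auto
  have "multilinear L ?p (volume_form us)"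
    unfolding multilinear_def
  proof (intro conjI ballI allI impI)
    fix xs i x assume A: "xs \<in> tuples L ?p" "i < ?p" "x \<in> carrier L"
    have cx: "c \<odot>\<^bsub>L\<^esub> x \<in> carrier L" for c using A by simp
    show "volume_form us (xs[i := c \<odot>\<^bsub>L\<^esub> x]) = c * volume_form us (xs[i := x])" for c
      unfolding expand[OF A(1,2) cx] expand[OF A] sum_distrib_left
      using A by (intro sum.cong refl) (simp add: linear_functional_smult[OF lin])
    fix y assume y: "y \<in> carrier L"
    have xy: "x \<oplus>\<^bsub>L\<^esub> y \<in> carrier L" using A y by simp
    show "volume_form us (xs[i := x \<oplus>\<^bsub>L\<^esub> y]) = volume_form us (xs[i := x]) + volume_form us (xs[i := y])"
      unfolding expand[OF A(1,2) xy] expand[OF A] expand[OF A(1,2) y] sum.distrib[symmetric]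
      using A y by (intro sum.cong refl) (simp add: linear_functional_add[OF lin] algebra_simps)
  qed
  moreover have "volume_form us xs = 0"
    if "xs \<in> tuples L ?p" "i < ?p" "j < ?p" "i \<noteq> j" "xs ! i = xs ! j" for xs i j
  proof -
    have "row (volume_matrix us xs) i = row (volume_matrix us xs) j"
      using that by (intro eq_vecI) (auto simp: volume_matrix_def)
    then show ?thesis
      using det_identical_rows[OF volume_matrix_carrier that(4,2,3)] by (simp add: volume_form_def)
  qed
  ultimately show ?thesis
    unfolding cochains_iff by (auto simp: volume_form_def)
qed

lemma volume_form_zero_row:
  assumes "k < length us" "\<And>u. u \<in> set us \<Longrightarrow> \<xi> u (xs ! k) = 0"
  shows "volume_form us xs = 0"
proof -
  have "(\<Prod>i = 0..<length us. \<xi> (us ! p i) (xs ! i)) = 0" if "p permutes {0..<length us}" for p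
    using assms that permutes_in_image[of p "{0..<length us}" k]
    by (intro prod_zero bexI[of _ k]) auto
  then have "(\<Sum>p | p permutes {0..<length us}.
      signof p * (\<Prod>i = 0..<length us. \<xi> (us ! p i) (xs ! i))) = 0"
    by (intro sum.neutral) auto
  then show ?thesis unfolding volume_form_def det_volume_matrix by simp
qed

lemma volume_form_zero_column:
  assumes "u \<in> set us" "\<And>x. x \<in> set xs \<Longrightarrow> \<xi> u x = 0"
  shows "volume_form us xs = 0"
proof (cases "xs \<in> tuples L (length us)")
  case True
  obtain c where c: "c < length us" "us ! c = u" using assms(1) by (auto simp: in_set_conv_nth)
  have "(\<Prod>i = 0..<length us. \<xi> (us ! p i) (xs ! i)) = 0" if p: "p permutes {0..<length us}" for p
  proof -
    obtain k where k: "k < length us" "p k = c"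
      using permutes_image[OF p] c by (metis (no_types, lifting) atLeastLessThan_iff imageE le0)
    then have "\<xi> (us ! p k) (xs ! k) = 0" using True c assms(2) by (auto simp: tuples_def)
    then show ?thesis using k by (intro prod_zero bexI[of _ k]) auto
  qed
  then have "(\<Sum>p | p permutes {0..<length us}.
      signof p * (\<Prod>i = 0..<length us. \<xi> (us ! p i) (xs ! i))) = 0"
    by (intro sum.neutral) auto
  then show ?thesis unfolding volume_form_def det_volume_matrix by simp
qed (simp add: volume_form_def)

lemma volume_form_self:
  assumes "distinct us" "set us \<subseteq> I"
  shows "volume_form us (map b us) = 1"
proof -
  have "volume_matrix us (map b us) = 1\<^sub>m (length us)"
    using assms by (intro eq_matI) (auto simp: volume_matrix_def \<xi>_b subset_iff nth_eq_iff_index_eq)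
  moreover have "map b us \<in> tuples L (length us)" using assms b_carrier by (auto simp: tuples_def)
  ultimately show ?thesis by (simp add: volume_form_def)
qed

text \<open>When the \<open>b u\<close> span an abelian ideal with a complementary subalgebra, the
  differential of the volume form is the form multiplied by the trace of the action on that ideal,
  and the hypothesis says that the action is off-diagonal. In general, a form that is multilinear
  and alternating need only be tested on tuples of distinct basis vectors. A nonzero term of the
  differential there requires that the entries outside the bracket are all but one of the vectors
  \<open>b u\<close>, and that the bracket has a nonzero coordinate at the missing index. By
  hypothesis one of the two bracketed vectors is then a \<open>b u\<close> other than the missing
  one, so it occurs outside the bracket as well, and the tuple is not distinct.\<close>

lemma volume_form_cocycle:
  assumes us: "distinct us" "set us \<subseteq> I"
    and moves: "\<And>i j u. i \<in> I \<Longrightarrow> j \<in> I \<Longrightarrow> u \<in> set us \<Longrightarrow> \<xi> u (bracket L (b i) (b j)) \<noteq> 0 \<Longrightarrow>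
      i \<in> set us - {u} \<or> j \<in> set us - {u}"
  shows "volume_form us \<in> cocycles L (length us)"
proof -
  let ?p = "length us"
  note cochain = volume_form_cochain[OF us(2)]
  note ml = multilinear_ce_diff[OF cochain]
  have "ce_diff L ?p (volume_form us) xs = 0" if xs: "xs \<in> tuples L (Suc ?p)" for xs
  proof (rule multilinear_eq_0_if_spanning[OF vs ml _ spanning _ xs])
    show "b ` I \<subseteq> carrier L" using b_carrier by auto
  next
    fix xs assume len: "length xs = Suc ?p" and xs: "set xs \<subseteq> b ` I"
    have xsL: "xs \<in> tuples L (Suc ?p)" using len xs b_carrier by (auto simp: tuples_def)
    show "ce_diff L ?p (volume_form us) xs = 0"
    proof (cases "distinct xs")
      case False
      then show ?thesis
        using multilinear_alternating_of_adjacent[OF vs ml _ xsL] ce_diff_adjacent_eq[OF cochain]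
        by auto
    next
      case True
      have "volume_form us (term_args xs k l) = 0" if kl: "k < l" "l \<le> ?p" for k l
      proof (rule ccontr)
        assume nz: "volume_form us (term_args xs k l) \<noteq> 0"
        let ?rest = "nths xs (- {k, l})"
        have "xs ! k \<in> b ` I" "xs ! l \<in> b ` I" using xs len kl nth_mem[of k xs] nth_mem[of l xs] by auto
        then obtain i j where ij: "i \<in> I" "j \<in> I" "xs ! k = b i" "xs ! l = b j" by auto
        have rest: "distinct ?rest" "xs ! k \<notin> set ?rest" "xs ! l \<notin> set ?rest"
          using True kl len by (auto simp: distinct_nthsI set_nths nth_eq_iff_index_eq)
        have len_rest: "Suc (length ?rest) = ?p"
          using term_args_tuples[OF xsL kl] by (simp add: term_args_def tuples_def)
        \<comment> \<open>no zero row: the remaining entries are basis vectors indexed by \<open>us\<close>\<close>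
        have "set ?rest \<subseteq> b ` set us"
        proof
          fix x assume x: "x \<in> set ?rest"
          then obtain r where r: "r \<in> I" "x = b r" using xs set_nths_subset by fastforce
          obtain m where m: "m < length ?rest" "?rest ! m = x" using x by (auto simp: in_set_conv_nth)
          have "r \<in> set us"
          proof (rule ccontr)
            assume "r \<notin> set us"
            then have "volume_form us (term_args xs k l) = 0"
              using r m us len_rest
              by (intro volume_form_zero_row[of "Suc m"]) (auto simp: term_args_def \<xi>_b subset_iff)
            then show False using nz by simp
          qed
          then show "x \<in> b ` set us" using r by auto
        qed
        then obtain R where R: "R \<subseteq> set us" "set ?rest = b ` R" by (meson subset_imageE)
        have "inj_on b R"
          using R us \<xi>_b by (intro inj_onI) (metis subsetD zero_neq_one)
        then have card_R: "Suc (card R) = ?p"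
          using R(2) len_rest distinct_card[OF rest(1)] card_image by metis
        have "finite R" using R finite_subset by blast
        \<comment> \<open>no zero column: an index of \<open>us\<close> missing from the rest occurs in the bracket\<close>
        have missing: "i \<in> set us - {u} \<or> j \<in> set us - {u}" if u: "u \<in> set us" "u \<notin> R" for u
        proof (rule moves[OF ij(1,2) u(1)], rule notI)
          assume z: "\<xi> u (bracket L (b i) (b j)) = 0"
          have "\<xi> u x = 0" if "x \<in> set (term_args xs k l)" for x
            using that z u R us ij by (auto simp: term_args_def \<xi>_b subset_iff)
          then show False using volume_form_zero_column[OF u(1)] nz by blast
        qed
        have "R \<noteq> set us" using card_R distinct_card[OF us(1)] by auto
        then obtain u where u: "u \<in> set us" "u \<notin> R" using R by blast
        have "i \<notin> R" "j \<notin> R" using rest R ij by auto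
        then obtain v where v: "v \<in> set us" "v \<noteq> u" "v \<notin> R" using missing[OF u] by auto
        then have "card (insert u (insert v R)) \<le> card (set us)"
          using u R by (intro card_mono) auto
        then show False
          using u v \<open>finite R\<close> card_R distinct_card[OF us(1)] by simp
      qed
      then show ?thesis by (simp add: ce_diff_def term_args_def case_prod_beta)
    qed
  qed
  then show ?thesis
    using cochain by (auto simp: cocycles_def ce_diff_def)
qed

text \<open>Every term of the differential has a bracket of two entries among its arguments. So tuples of
  commuting vectors are test chains on which cohomology classes can be evaluated.\<close>

lemma coboundary_vanishes_on_commuting:
  assumes f: "f \<in> coboundaries L (length xs)" and xs: "set xs \<subseteq> carrier L"
    and comm: "\<And>x y. x \<in> set xs \<Longrightarrow> y \<in> set xs \<Longrightarrow> bracket L x y = \<zero>\<^bsub>L\<^esub>"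
  shows "f xs = 0"
proof (cases "length xs")
  case 0
  then show ?thesis using f by (simp add: coboundaries_def)
next
  case (Suc p)
  then obtain g where g: "g \<in> cochains L p" "f = ce_diff L p g"
    using f by (auto simp: coboundaries_def)
  have xsL: "xs \<in> tuples L (Suc p)" using Suc xs by (simp add: tuples_def)
  have "g (term_args xs i j) = 0" if ij: "i < j" "j \<le> p" for i j
  proof -
    have "term_args xs i j = (term_args xs i j)[0 := 0 \<odot>\<^bsub>L\<^esub> \<zero>\<^bsub>L\<^esub>]"
      using ij Suc by (simp add: term_args_def L.lmult_0 comm)
    moreover have "multilinear L p g" using g by (simp add: cochains_iff)
    ultimately show ?thesis
      using multilinear_smult[of L p g "term_args xs i j" 0 "\<zero>\<^bsub>L\<^esub>" 0] ij
        term_args_tuples[OF xsL ij] by simp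
  qed
  then show ?thesis by (simp add: g ce_diff_def term_args_def case_prod_beta)
qed

end

section \<open>Total cohomology as a quotient of the total cocycles\<close>

lemma cochains_zero: "(\<lambda>xs. 0) \<in> cochains L p"
  by (simp add: cochains_def)

lemma cochains_add: "f \<in> cochains L p \<Longrightarrow> g \<in> cochains L p \<Longrightarrow> (\<lambda>xs. f xs + g xs) \<in> cochains L p"
  unfolding cochains_iff multilinear_def by (simp add: distrib_left)

lemma cochains_smult: "f \<in> cochains L p \<Longrightarrow> (\<lambda>xs. c * f xs) \<in> cochains L p"
  unfolding cochains_iff multilinear_def by (simp add: algebra_simps)

lemma ce_diff_zero: "ce_diff L p (\<lambda>xs. 0) = (\<lambda>xs. 0)"
  by (rule ext) (simp add: ce_diff_def)

lemma ce_diff_add: "ce_diff L p (\<lambda>xs. f xs + g xs) = (\<lambda>xs. ce_diff L p f xs + ce_diff L p g xs)"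
  by (rule ext) (simp add: ce_diff_def case_prod_beta distrib_left sum.distrib)

lemma ce_diff_smult: "ce_diff L p (\<lambda>xs. c * f xs) = (\<lambda>xs. c * ce_diff L p f xs)"
  by (rule ext) (simp add: ce_diff_def case_prod_beta sum_distrib_left mult.left_commute)

lemma cocycles_zero: "(\<lambda>xs. 0) \<in> cocycles L p"
  by (simp add: cocycles_def cochains_zero ce_diff_zero)

lemma cocycles_add: "f \<in> cocycles L p \<Longrightarrow> g \<in> cocycles L p \<Longrightarrow> (\<lambda>xs. f xs + g xs) \<in> cocycles L p"
  by (simp add: cocycles_def cochains_add ce_diff_add)

lemma cocycles_smult: "f \<in> cocycles L p \<Longrightarrow> (\<lambda>xs. c * f xs) \<in> cocycles L p"
  by (simp add: cocycles_def cochains_smult ce_diff_smult)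

lemma coboundaries_zero: "(\<lambda>xs. 0) \<in> coboundaries L p"
proof (cases p)
  case (Suc q)
  then show ?thesis
    using imageI[OF cochains_zero, of "ce_diff L q" L q] by (simp add: coboundaries_def ce_diff_zero)
qed (simp add: coboundaries_def)

lemma coboundaries_add:
  "f \<in> coboundaries L p \<Longrightarrow> g \<in> coboundaries L p \<Longrightarrow> (\<lambda>xs. f xs + g xs) \<in> coboundaries L p"
  using cochains_add by (fastforce simp: coboundaries_def image_iff simp flip: ce_diff_add split: nat.splits)

lemma coboundaries_smult: "f \<in> coboundaries L p \<Longrightarrow> (\<lambda>xs. c * f xs) \<in> coboundaries L p"
  using cochains_smult by (fastforce simp: coboundaries_def image_iff simp flip: ce_diff_smult split: nat.splits)

text \<open>Families of cocycles, one in each degree. The cohomology of a finite-dimensional algebra vanishes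
  above its dimension, hence there all such
  families map to the total cohomology, and the map is surjective.\<close>

definition total_cocycles :: "'a lie_algebra \<Rightarrow> (complex, nat \<Rightarrow> 'a list \<Rightarrow> complex) module" where
  "total_cocycles L =
     \<lparr>carrier = {z. \<forall>p. z p \<in> cocycles L p}, mult = undefined, one = undefined,
      zero = (\<lambda>p xs. 0), add = (\<lambda>z w p xs. z p xs + w p xs), smult = (\<lambda>c z p xs. c * z p xs)\<rparr>"

lemma vectorspace_total_cocycles: "vectorspace class_ring (total_cocycles L)"
  by (rule complex_vectorspaceI)
    (auto simp: total_cocycles_def cocycles_zero cocycles_add cocycles_smult algebra_simps)

definition cohomology_class :: "'a lie_algebra \<Rightarrow> nat \<Rightarrow> ('a list \<Rightarrow> complex) \<Rightarrow> ('a list \<Rightarrow> complex) set" where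
  "cohomology_class L p f = {(\<lambda>xs. w xs + f xs) | w. w \<in> coboundaries L p}"

lemma cohomology_class_carrier:
  "carrier (cohomology L p) = cohomology_class L p ` cocycles L p"
  by (auto simp: cohomology_def quotient_space_def A_RCOSETS_def' a_r_coset_def' cochain_space_def
      cohomology_class_def)

lemma cohomology_class_zero: "cohomology_class L p (\<lambda>xs. 0) = \<zero>\<^bsub>cohomology L p\<^esub>"
  by (simp add: cohomology_def quotient_space_def cohomology_class_def)

lemma cohomology_class_self: "f \<in> cohomology_class L p f"
  using coboundaries_zero[of L p] by (auto simp: cohomology_class_def intro!: exI[of _ "\<lambda>xs. 0"])

lemma cohomology_class_add:
  "cohomology_class L p (\<lambda>xs. f xs + g xs) =
    cohomology_class L p f \<oplus>\<^bsub>cohomology L p\<^esub> cohomology_class L p g" (is "?A = ?B")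
proof
  show "?A \<subseteq> ?B"
  proof
    fix h assume "h \<in> ?A"
    then obtain w where w: "w \<in> coboundaries L p" "h = (\<lambda>xs. w xs + (f xs + g xs))"
      by (auto simp: cohomology_class_def)
    then have "(\<lambda>xs. w xs + f xs) \<in> cohomology_class L p f" "g \<in> cohomology_class L p g"
      using cohomology_class_self by (auto simp: cohomology_class_def)
    moreover have "h = (\<lambda>xs. (w xs + f xs) + g xs)" using w by (simp add: add.assoc)
    ultimately show "h \<in> ?B"
      by (auto simp: cohomology_def quotient_space_def cochain_space_def set_add_def')
  qed
  show "?B \<subseteq> ?A"
  proof
    fix h assume "h \<in> ?B"
    then obtain v w where "v \<in> coboundaries L p" "w \<in> coboundaries L p"
        "h = (\<lambda>xs. (v xs + f xs) + (w xs + g xs))"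
      by (auto simp: cohomology_def quotient_space_def cochain_space_def set_add_def' cohomology_class_def)
    moreover from this have "(\<lambda>xs. v xs + w xs) \<in> coboundaries L p" by (intro coboundaries_add)
    ultimately show "h \<in> ?A"
      unfolding cohomology_class_def by (auto intro!: exI[of _ "\<lambda>xs. v xs + w xs"] simp: algebra_simps)
  qed
qed

lemma cohomology_class_smult:
  "cohomology_class L p (\<lambda>xs. c * f xs) = c \<odot>\<^bsub>cohomology L p\<^esub> cohomology_class L p f" (is "?A = ?B")
proof
  have B: "?B = (\<Union>x \<in> cohomology_class L p f. cohomology_class L p (\<lambda>xs. c * x xs))"
    by (auto simp: cohomology_def quotient_space_def cochain_space_def a_r_coset_def' cohomology_class_def)
  show "?A \<subseteq> ?B" unfolding B using cohomology_class_self[of f L p] by blast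
  show "?B \<subseteq> ?A"
  proof
    fix h assume "h \<in> ?B"
    then obtain v w where vw: "v \<in> coboundaries L p" "w \<in> coboundaries L p"
        "h = (\<lambda>xs. v xs + c * (w xs + f xs))"
      unfolding B by (auto simp: cohomology_class_def)
    have "(\<lambda>xs. v xs + c * w xs) \<in> coboundaries L p"
      using vw by (intro coboundaries_add coboundaries_smult)
    moreover have "h = (\<lambda>xs. (v xs + c * w xs) + c * f xs)" using vw by (simp add: algebra_simps)
    ultimately show "h \<in> ?A"
      unfolding cohomology_class_def by (intro CollectI exI[of _ "\<lambda>xs. v xs + c * w xs"] conjI)
  qed
qed

text \<open>Representatives of the classes can be chosen in all degrees independently, and the finiteness
  condition in the direct sum is automatic, since only degrees up to \<open>N\<close> contribute.\<close>

lemma linear_map_cohomology_class: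
  assumes "\<And>p. p > N \<Longrightarrow> cocycles L p \<subseteq> {\<lambda>xs. 0}"
  defines "f \<equiv> (\<lambda>z p. cohomology_class L p (z p))"
  shows "f ` carrier (total_cocycles L) = carrier (total_cohomology L)"
    and "linear_map class_ring (total_cocycles L) (total_cohomology L) f"
proof -
  show surj: "f ` carrier (total_cocycles L) = carrier (total_cohomology L)" (is "?A = ?B")
  proof
    show "?A \<subseteq> ?B"
    proof
      fix h assume "h \<in> ?A"
      then obtain z where z: "\<And>p. z p \<in> cocycles L p" "h = (\<lambda>p. cohomology_class L p (z p))"
        by (auto simp: f_def total_cocycles_def)
      have "h p = \<zero>\<^bsub>cohomology L p\<^esub>" if "p > N" for p
      proof -
        have "z p = (\<lambda>xs. 0)" using assms(1)[OF that] z(1)[of p] by auto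
        then show ?thesis by (simp add: z(2) cohomology_class_zero)
      qed
      then have "{p. h p \<noteq> \<zero>\<^bsub>cohomology L p\<^esub>} \<subseteq> {..N}" by (auto simp: not_le[symmetric])
      then have "finite {p. h p \<noteq> \<zero>\<^bsub>cohomology L p\<^esub>}" by (rule finite_subset) simp
      then show "h \<in> ?B"
        using z by (auto simp: total_cohomology_def graded_sum_def cohomology_class_carrier)
    qed
    show "?B \<subseteq> ?A"
    proof
      fix h assume "h \<in> ?B"
      then have "\<forall>p. \<exists>g. g \<in> cocycles L p \<and> h p = cohomology_class L p g"
        by (auto simp: total_cohomology_def graded_sum_def cohomology_class_carrier)
      then obtain z where "\<And>p. z p \<in> cocycles L p" "\<And>p. h p = cohomology_class L p (z p)" by metis
      then have "h = f z" "z \<in> carrier (total_cocycles L)" by (auto simp: f_def total_cocycles_def)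
      then show "h \<in> ?A" by blast
    qed
  qed
  show "linear_map class_ring (total_cocycles L) (total_cohomology L) f"
    by (rule linear_map_onto_image[OF vectorspace_total_cocycles surj])
      (simp_all add: f_def total_cocycles_def total_cohomology_def graded_sum_def
        cohomology_class_zero cohomology_class_add cohomology_class_smult)
qed

lemma cohomology_class_eq_zero:
  "cohomology_class L p f = \<zero>\<^bsub>cohomology L p\<^esub> \<Longrightarrow> f \<in> coboundaries L p"
  using cohomology_class_self[of f L p] by (simp add: cohomology_def quotient_space_def)

context based_alternating_algebra
begin

lemma b_image_carrier: "b ` I \<subseteq> carrier L"
  using b_carrier by auto

lemma cochain_eq_0_if_basis:
  assumes f: "f \<in> cochains L p" and "\<And>xs. length xs = p \<Longrightarrow> set xs \<subseteq> b ` I \<Longrightarrow> f xs = 0"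
  shows "f = (\<lambda>xs. 0)"
proof
  fix xs
  have "multilinear L p f" using f by (simp add: cochains_iff)
  then show "f xs = 0"
    using multilinear_eq_0_if_spanning[OF vs _ b_image_carrier spanning assms(2)] f
    by (cases "xs \<in> tuples L p") (auto simp: cochains_iff)
qed

lemma cochains_above_dim:
  assumes "p > card I"
  shows "cochains L p \<subseteq> {\<lambda>xs. 0}"
proof
  fix f assume f: "f \<in> cochains L p"
  have "f xs = 0" if xs: "length xs = p" "set xs \<subseteq> b ` I" for xs
  proof -
    have "card (set xs) \<le> card I"
      using card_mono[OF _ xs(2)] card_image_le[OF finite_I, of b] finite_I by fastforce
    then have "\<not> distinct xs" using assms xs distinct_card by fastforce
    then show ?thesis
      using cochain_alternating[OF f] xs b_image_carrier by (auto simp: tuples_def)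
  qed
  then show "f \<in> {\<lambda>xs. 0}" using cochain_eq_0_if_basis[OF f] by simp
qed

text \<open>Evaluation at the finitely many lists of basis vectors of bounded length separates cocycles.\<close>

lemma fin_dim_total_cocycles: "vectorspace.fin_dim class_ring (total_cocycles L)"
proof -
  let ?X = "{ys. set ys \<subseteq> b ` I \<and> length ys \<le> card I}"
  let ?e = "\<lambda>ys z. z (length ys) ys"
  have "vectorspace.fin_dim class_ring (total_cocycles L) \<and> cdim (total_cocycles L) \<le> card ?X"
  proof (rule dim_le_card_separating_functionals[where e = ?e, OF vectorspace_total_cocycles])
    show "finite ?X" using finite_I by (intro finite_lists_length_le) auto
    show "linear_functional (total_cocycles L) (?e ys)" for ys
      by (simp add: linear_functional_def total_cocycles_def)
  next
    fix z assume z: "z \<in> carrier (total_cocycles L)" and 0: "\<And>ys. ys \<in> ?X \<Longrightarrow> z (length ys) ys = 0"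
    have "z p = (\<lambda>xs. 0)" for p
    proof -
      have zp: "z p \<in> cochains L p" using z by (simp add: total_cocycles_def cocycles_def)
      show ?thesis
      proof (cases "p \<le> card I")
        case True
        then show ?thesis using 0 by (intro cochain_eq_0_if_basis[OF zp]) auto
      next
        case False
        then show ?thesis using cochains_above_dim[of p] zp by auto
      qed
    qed
    then show "z = \<zero>\<^bsub>total_cocycles L\<^esub>" by (auto simp: total_cocycles_def)
  qed
  then show ?thesis ..
qed

text \<open>Each \<open>U\<close> contributes the class of its volume form and the functional that evaluates a
  cocycle at the basis vectors of \<open>U\<close>. The functional ignores coboundaries because
  these vectors commute. The volume form of \<open>V\<close> has value \<open>1\<close> at the
  vectors of \<open>V\<close> and \<open>0\<close> at those of another \<open>U\<close> of the
  same size, which lack a vector of \<open>V\<close>.\<close>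

theorem card_le_dim_total_cohomology:
  assumes sub: "\<U> \<subseteq> Pow I"
    and moves: "\<And>U i j u. U \<in> \<U> \<Longrightarrow> i \<in> I \<Longrightarrow> j \<in> I \<Longrightarrow> u \<in> U \<Longrightarrow>
      \<xi> u (bracket L (b i) (b j)) \<noteq> 0 \<Longrightarrow> i \<in> U - {u} \<or> j \<in> U - {u}"
    and comm: "\<And>U i j. U \<in> \<U> \<Longrightarrow> i \<in> U \<Longrightarrow> j \<in> U \<Longrightarrow> bracket L (b i) (b j) = \<zero>\<^bsub>L\<^esub>"
  shows "card \<U> \<le> cdim (total_cohomology L)"
proof -
  have "\<exists>us. distinct us \<and> set us = U" if "U \<in> \<U>" for U
    using that sub finite_subset[OF _ finite_I, of U] finite_distinct_list[of U] by auto
  then obtain us where us: "\<And>U. U \<in> \<U> \<Longrightarrow> distinct (us U)" "\<And>U. U \<in> \<U> \<Longrightarrow> set (us U) = U"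
    by metis
  define z where "z U p = (if p = length (us U) then volume_form (us U) else (\<lambda>xs. 0))" for U p
  define e where "e U (y :: nat \<Rightarrow> 'a list \<Rightarrow> complex) = y (length (us U)) (map b (us U))" for U y
  have N: "cocycles L p \<subseteq> {\<lambda>xs. 0}" if "p > card I" for p
    using cochains_above_dim[OF that] by (auto simp: cocycles_def)
  show ?thesis
  proof (rule card_le_dim_of_dual_family[OF linear_map_cohomology_class(2)[OF N] fin_dim_total_cocycles
        linear_map_cohomology_class(1)[OF N], where u = z and e = e])
    show "finite \<U>" using sub finite_I finite_subset by blast
  next
    fix U assume U: "U \<in> \<U>"
    have UI: "set (us U) \<subseteq> I" using U us sub by auto
    have "volume_form (us U) \<in> cocycles L (length (us U))"
      using moves[OF U] us[OF U] UI by (intro volume_form_cocycle) auto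
    then show "z U \<in> carrier (total_cocycles L)"
      by (simp add: z_def total_cocycles_def cocycles_zero)
    show "linear_functional (total_cocycles L) (e U)"
      by (simp add: e_def linear_functional_def total_cocycles_def)
    fix y assume "(\<lambda>p. cohomology_class L p (y p)) = \<zero>\<^bsub>total_cohomology L\<^esub>"
    then have "cohomology_class L p (y p) = \<zero>\<^bsub>cohomology L p\<^esub>" for p
      by (simp add: total_cohomology_def graded_sum_def fun_eq_iff)
    then have "y p \<in> coboundaries L p" for p by (rule cohomology_class_eq_zero)
    then show "e U y = 0"
      unfolding e_def using comm[OF U] us(2)[OF U] UI b_carrier
      by (intro coboundary_vanishes_on_commuting) auto
  next
    fix U V assume UV: "U \<in> \<U>" "V \<in> \<U>"
    have sets: "set (us U) \<subseteq> I" "set (us V) \<subseteq> I" using UV us sub by auto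
    show "e U (z V) = (if U = V then 1 else 0)"
    proof (cases "U = V")
      case True
      then show ?thesis using us UV sets by (simp add: e_def z_def volume_form_self)
    next
      case False
      have "volume_form (us V) (map b (us U)) = 0" if len: "length (us U) = length (us V)"
      proof -
        have "card U = card V" using len us UV distinct_card by metis
        then have "\<not> V \<subseteq> U" using False sets UV us card_subset_eq[of U V] finite_subset[OF _ finite_I, of U] by auto
        then obtain v where "v \<in> V" "v \<notin> U" by auto
        then show ?thesis
          using us UV sets by (intro volume_form_zero_column[of v]) (auto simp: \<xi>_b subset_iff)
      qed
      then show ?thesis using False by (simp add: e_def z_def)
    qed
  qed
qed

end

section \<open>Monomial derivations\<close>

lemma lookup_const_mult: "Poly_Mapping.lookup (const c * p) m = c * Poly_Mapping.lookup p m"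
  unfolding const_def mult_map_scale_conv_mult[symmetric] by (simp add: Poly_Mapping.map.rep_eq when_def)

lemma const_mult_const: "const a * const c = const (a * c)"
  by (simp add: const_def mult_single)

lemma const_add: "const (a + c) = const a + const c"
  by (simp add: const_def single_add)

lemma const_0: "const 0 = 0" and const_1: "const 1 = 1"
  by (simp_all add: const_def)

lemma const_mult_single: "const c * Poly_Mapping.single m a = Poly_Mapping.single m (c * a)"
  by (simp add: const_def mult_single)

lemma cpoly_induct [case_names zero add]:
  assumes "P (0 :: cpoly)" and "\<And>m c p. P p \<Longrightarrow> P (Poly_Mapping.single m c + p)"
  shows "P p"
proof (induction p rule: update_induct)
  case const
  show ?case by (rule assms(1))
next
  case (update f a b)
  have "Poly_Mapping.update a b f = Poly_Mapping.single a b + f"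
    using update.hyps
    by (intro poly_mapping_eqI) (auto simp: update.rep_eq lookup_add lookup_single when_def in_keys_iff)
  then show ?case using assms(2)[OF update.IH] by simp
qed

lemma lookup_pderiv_op:
  "Poly_Mapping.lookup (pderiv_op i p) m =
    of_nat (Suc (Poly_Mapping.lookup m i)) * Poly_Mapping.lookup p (m + Poly_Mapping.single i 1)"
proof -
  let ?e = "Poly_Mapping.single i 1 :: nat \<Rightarrow>\<^sub>0 nat"
  have "Poly_Mapping.lookup (pderiv_op i p) m = (\<Sum>k\<in>Poly_Mapping.keys p.
      (of_nat (Poly_Mapping.lookup k i) * Poly_Mapping.lookup p k) when k - ?e = m)"
    by (simp add: pderiv_op_def lookup_sum lookup_single)
  also have "\<dots> = (\<Sum>k\<in>Poly_Mapping.keys p. if k = m + ?e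
      then of_nat (Suc (Poly_Mapping.lookup m i)) * Poly_Mapping.lookup p k else 0)"
  proof (intro sum.cong refl)
    fix k :: "nat \<Rightarrow>\<^sub>0 nat"
    have "k = m + ?e" if "k - ?e = m" "Poly_Mapping.lookup k i \<noteq> 0"
    proof (rule poly_mapping_eqI)
      fix j show "Poly_Mapping.lookup k j = Poly_Mapping.lookup (m + ?e) j"
        using that by (auto simp: lookup_add lookup_minus lookup_single when_def simp flip: that(1))
    qed
    then have iff: "k - ?e = m \<longleftrightarrow> k = m + ?e" if "Poly_Mapping.lookup k i \<noteq> 0"
      using that by auto
    show "((of_nat (Poly_Mapping.lookup k i) * Poly_Mapping.lookup p k) when k - ?e = m) =
      (if k = m + ?e then of_nat (Suc (Poly_Mapping.lookup m i)) * Poly_Mapping.lookup p k else 0)"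
    proof (cases "Poly_Mapping.lookup k i = 0")
      case True
      then have "k \<noteq> m + ?e" by (auto simp: lookup_add)
      then show ?thesis using True by simp
    next
      case False
      have "Poly_Mapping.lookup k i = Suc (Poly_Mapping.lookup m i)" if "k = m + ?e"
        unfolding that by (simp add: lookup_add)
      then show ?thesis
        unfolding when_def iff[OF False] by (intro if_cong refl arg_cong2[where f = "(*)"]) metis
    qed
  qed
  also have "\<dots> = of_nat (Suc (Poly_Mapping.lookup m i)) * Poly_Mapping.lookup p (m + ?e)"
    by (simp add: sum.delta in_keys_iff)
  finally show ?thesis .
qed

lemma pderiv_op_0: "pderiv_op i 0 = 0"
  by (simp add: pderiv_op_def)

lemma pderiv_op_add: "pderiv_op i (p + q) = pderiv_op i p + pderiv_op i q"
  by (intro poly_mapping_eqI) (simp add: lookup_pderiv_op lookup_add algebra_simps)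

lemma pderiv_op_const_mult: "pderiv_op i (const c * p) = const c * pderiv_op i p"
  by (intro poly_mapping_eqI) (simp add: lookup_pderiv_op lookup_const_mult)

lemma pderiv_op_single:
  "pderiv_op i (Poly_Mapping.single m c) =
    Poly_Mapping.single (m - Poly_Mapping.single i 1) (of_nat (Poly_Mapping.lookup m i) * c)"
  by (cases "c = 0") (simp_all add: pderiv_op_def)

lemma pderiv_op_commute: "pderiv_op i (pderiv_op j p) = pderiv_op j (pderiv_op i p)"
  by (intro poly_mapping_eqI)
    (cases "i = j"; simp add: lookup_pderiv_op lookup_add lookup_single when_def add.assoc add.left_commute
      add.commute mult.left_commute)

text \<open>Both sides are bilinear, so the product rule reduces to monomials. The truncated subtraction of
  exponents is additive except where the exponent to be lowered is \<open>0\<close>, and there the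
  coefficient is \<open>0\<close>.\<close>

lemma pderiv_op_mult: "pderiv_op i (p * q) = pderiv_op i p * q + p * pderiv_op i q"
proof -
  let ?e = "Poly_Mapping.single i 1 :: nat \<Rightarrow>\<^sub>0 nat"
  have e: "m - ?e + k = m + k - ?e" if "Poly_Mapping.lookup m i \<noteq> 0" for m k
  proof (rule poly_mapping_eqI)
    fix j show "Poly_Mapping.lookup (m - ?e + k) j = Poly_Mapping.lookup (m + k - ?e) j"
      using that by (auto simp: lookup_add lookup_minus lookup_single when_def)
  qed
  have single: "pderiv_op i (Poly_Mapping.single m c * Poly_Mapping.single k a) =
      pderiv_op i (Poly_Mapping.single m c) * Poly_Mapping.single k a
      + Poly_Mapping.single m c * pderiv_op i (Poly_Mapping.single k a)" for m k c a
  proof -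
    have "Poly_Mapping.single (m - ?e + k) (of_nat (Poly_Mapping.lookup m i) * c * a)
        = Poly_Mapping.single (m + k - ?e) (of_nat (Poly_Mapping.lookup m i) * c * a)"
      using e[of m k] by (cases "Poly_Mapping.lookup m i = 0") auto
    moreover have "Poly_Mapping.single (m + (k - ?e)) (c * (of_nat (Poly_Mapping.lookup k i) * a))
        = Poly_Mapping.single (m + k - ?e) (c * (of_nat (Poly_Mapping.lookup k i) * a))"
      using e[of k m] by (cases "Poly_Mapping.lookup k i = 0") (auto simp: add.commute)
    ultimately show ?thesis
      by (simp add: pderiv_op_single mult_single lookup_add algebra_simps flip: single_add)
  qed
  have "pderiv_op i (Poly_Mapping.single m c * q) = pderiv_op i (Poly_Mapping.single m c) * q
      + Poly_Mapping.single m c * pderiv_op i q" for m c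
    by (induction q rule: cpoly_induct) (simp_all add: pderiv_op_0 distrib_left pderiv_op_add single)
  then show ?thesis
    by (induction p rule: cpoly_induct) (simp_all add: pderiv_op_0 distrib_right pderiv_op_add)
qed

lemma var_power: "var j ^ m = Poly_Mapping.single (Poly_Mapping.single j m) 1"
  by (induction m) (simp_all add: var_def mult_single flip: single_add)

lemma pderiv_op_var: "pderiv_op i (var j) = (if i = j then 1 else 0)"
  by (auto simp: var_def pderiv_op_single lookup_single when_def)

text \<open>The vector field \<open>x\<^sup>a \<partial>\<^sub>k\<close>.\<close>

definition monomial_derivation :: "nat \<Rightarrow> (nat \<Rightarrow>\<^sub>0 nat) \<Rightarrow> operator" where
  "monomial_derivation k a p = Poly_Mapping.single a 1 * pderiv_op k p"

lemma monomial_derivation_var: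
  "monomial_derivation k a (var l) = (if k = l then Poly_Mapping.single a 1 else 0)"
  by (simp add: monomial_derivation_def pderiv_op_var)

lemma bracket_monomial_derivations:
  "bracket (diff_op_algebra n) (monomial_derivation j a) (monomial_derivation k c) p =
     const (of_nat (Poly_Mapping.lookup c j)) *
       monomial_derivation k (a + (c - Poly_Mapping.single j 1)) p -
     const (of_nat (Poly_Mapping.lookup a k)) *
       monomial_derivation j (c + (a - Poly_Mapping.single k 1)) p"
proof -
  have "monomial_derivation j a (monomial_derivation k c p) =
      const (of_nat (Poly_Mapping.lookup c j)) *
        monomial_derivation k (a + (c - Poly_Mapping.single j 1)) p
      + Poly_Mapping.single (a + c) 1 * pderiv_op j (pderiv_op k p)" for j k a c
    by (simp add: monomial_derivation_def pderiv_op_mult pderiv_op_single distrib_left mult_single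
        const_mult_single flip: mult.assoc)
  from this[of j a k c] this[of k c j a] show ?thesis
    by (simp add: diff_op_algebra_def add.commute[of a c] pderiv_op_commute[of k j])
qed

text \<open>A span is a subalgebra as soon as it contains the brackets of its generators.\<close>

lemma (in alternating_algebra) bracket_lin_span:
  assumes G: "G \<subseteq> carrier L"
    and br: "\<And>x y. x \<in> G \<Longrightarrow> y \<in> G \<Longrightarrow> bracket L x y \<in> lin_span L G"
    and "x \<in> lin_span L G" "y \<in> lin_span L G"
  shows "bracket L x y \<in> lin_span L G"
proof -
  have sub: "x \<in> carrier L" if "x \<in> lin_span L G" for x
    using that G by induction auto
  have zero_left: "bracket L \<zero>\<^bsub>L\<^esub> z = \<zero>\<^bsub>L\<^esub>" and zero_right: "bracket L z \<zero>\<^bsub>L\<^esub> = \<zero>\<^bsub>L\<^esub>"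
    if "z \<in> carrier L" for z
    using bracket_smult_left[of "\<zero>\<^bsub>L\<^esub>" z 0] bracket_smult_right[of "\<zero>\<^bsub>L\<^esub>" z 0] that
      L.lmult_0[of "\<zero>\<^bsub>L\<^esub>"] L.lmult_0[of "bracket L \<zero>\<^bsub>L\<^esub> z"] L.lmult_0[of "bracket L z \<zero>\<^bsub>L\<^esub>"]
    by (simp_all add: bracket_closed)
  have left: "bracket L x y \<in> lin_span L G" if "x \<in> G" "y \<in> lin_span L G" for x y
    using that(2)
  proof induction
    case (gen y)
    then show ?case using br that by auto
  next
    case zero
    then show ?case using zero_right that(1) G lin_span.zero[of L G] by auto
  next
    case (add y z)
    have "bracket L x (y \<oplus>\<^bsub>L\<^esub> z) = bracket L x y \<oplus>\<^bsub>L\<^esub> bracket L x z"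
      using add.hyps sub that(1) G by (intro bracket_add_right) auto
    then show ?case using lin_span.add[OF add.IH] by simp
  next
    case (smult y c)
    have "bracket L x (c \<odot>\<^bsub>L\<^esub> y) = c \<odot>\<^bsub>L\<^esub> bracket L x y"
      using smult.hyps sub that(1) G by (intro bracket_smult_right) auto
    then show ?case using lin_span.smult[OF smult.IH] by simp
  qed
  show ?thesis
    using assms(3)
  proof induction
    case (gen x)
    then show ?case using left assms(4) by auto
  next
    case zero
    then show ?case using zero_left sub[OF assms(4)] lin_span.zero[of L G] by auto
  next
    case (add x z)
    have "bracket L (x \<oplus>\<^bsub>L\<^esub> z) y = bracket L x y \<oplus>\<^bsub>L\<^esub> bracket L z y"
      using add.hyps sub assms(4) by (intro bracket_add_left) auto
    then show ?case using lin_span.add[OF add.IH] by simp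
  next
    case (smult x c)
    have "bracket L (c \<odot>\<^bsub>L\<^esub> x) y = c \<odot>\<^bsub>L\<^esub> bracket L x y"
      using smult.hyps sub assms(4) by (intro bracket_smult_left) auto
    then show ?case using lin_span.smult[OF smult.IH] by simp
  qed
qed

section \<open>The Lie algebra of a tree diagram\<close>

locale tree_diagram =
  fixes n :: nat and E :: "(nat \<times> nat) set" and d :: "nat \<times> nat \<Rightarrow> nat"
  assumes diagram: "oriented_tree_diagram n E d"
begin

abbreviation L :: "operator lie_algebra" where
  "L \<equiv> tree_lie_algebra n E d"

lemma L_simps:
  "\<zero>\<^bsub>L\<^esub> = (\<lambda>p. 0)" "S \<oplus>\<^bsub>L\<^esub> T = (\<lambda>p. S p + T p)" "c \<odot>\<^bsub>L\<^esub> T = (\<lambda>p. const c * T p)"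
  "bracket L S T = (\<lambda>p. S (T p) - T (S p))"
  "carrier L = lie_span (diff_op_algebra n) (tree_generators n E d)"
  by (simp_all add: tree_lie_algebra_def diff_op_algebra_def)

lemma L_closed:
  "(\<lambda>p. 0) \<in> carrier L"
  "S \<in> carrier L \<Longrightarrow> T \<in> carrier L \<Longrightarrow> (\<lambda>p. S p + T p) \<in> carrier L"
  "T \<in> carrier L \<Longrightarrow> (\<lambda>p. const c * T p) \<in> carrier L"
  "S \<in> carrier L \<Longrightarrow> T \<in> carrier L \<Longrightarrow> (\<lambda>p. S (T p) - T (S p)) \<in> carrier L"
  using lie_span.zero[of "diff_op_algebra n"] lie_span.add[of S "diff_op_algebra n" _ T]
    lie_span.smult[of T "diff_op_algebra n" _ c] lie_span.bracket[of S "diff_op_algebra n" _ T]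
  by (simp_all add: tree_lie_algebra_def diff_op_algebra_def)

lemma L_linear:
  assumes "T \<in> carrier L"
  shows "T (p + q) = T p + T q" "T (const c * p) = const c * T p"
proof -
  have "(\<forall>p q. T (p + q) = T p + T q) \<and> (\<forall>c p. T (const c * p) = const c * T p)"
    using assms[unfolded L_simps]
  proof induction
    case (gen T)
    then show ?case
      by (auto simp: tree_generators_def pderiv_op_add pderiv_op_const_mult distrib_left
          mult.left_commute)
  qed (simp_all add: diff_op_algebra_def algebra_simps)
  then show "T (p + q) = T p + T q" "T (const c * p) = const c * T p" by auto
qed

lemma L_diff: "T \<in> carrier L \<Longrightarrow> T (p - q) = T p - T q"
  using L_linear(1)[of T "p - q" q] by simp

sublocale alternating_algebra L
proof (rule alternating_algebra.intro)
  show "vectorspace class_ring L"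
    by (rule complex_vectorspaceI; unfold L_simps(1-3))
      (auto simp: L_closed const_0 const_1 const_add distrib_left distrib_right mult.assoc add.assoc
        add.commute add.left_commute simp flip: const_mult_const)
qed (simp_all add: L_simps(1-4) L_closed L_linear L_diff right_diff_distrib fun_eq_iff)

text \<open>No variable of a sink occurs in the coefficients of an
  element of the algebra, which makes the vector fields in the directions of the sinks commute.\<close>

definition nonsink :: "nat \<Rightarrow> bool" where
  "nonsink i \<longleftrightarrow> (\<exists>l. (i, l) \<in> E)"

definition sinks :: "nat set" where
  "sinks = {k \<in> {1..n}. \<not> nonsink k}"

text \<open>Not below any edge weight, so that \<open>d (j, k) * base ^ j \<le> base ^ k\<close> on every
  edge. When \<open>x\<^sub>i\<close> has degree \<open>base ^ i\<close>, the coefficient of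
  \<open>\<partial>\<^sub>k\<close> in a generator therefore has at most the degree of
  \<open>x\<^sub>k\<close>, and brackets preserve this bound.\<close>

definition base :: nat where
  "base = Suc (\<Sum>e\<in>E. d e)"

definition weight :: "(nat \<Rightarrow>\<^sub>0 nat) \<Rightarrow> nat" where
  "weight a = (\<Sum>i = 1..n. Poly_Mapping.lookup a i * base ^ i)"

definition admissible :: "(nat \<Rightarrow>\<^sub>0 nat) \<times> nat \<Rightarrow> bool" where
  "admissible = (\<lambda>(a, k). k \<in> {1..n} \<and> weight a \<le> base ^ k \<and>
     (\<forall>i. Poly_Mapping.lookup a i \<noteq> 0 \<longrightarrow> 1 \<le> i \<and> i < k \<and> nonsink i))"

text \<open>Of the admissible monomial fields only those that lie in the algebra are kept; they turn out to be
  a basis of it.\<close>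

definition indices :: "((nat \<Rightarrow>\<^sub>0 nat) \<times> nat) set" where
  "indices = {(a, k). admissible (a, k) \<and> monomial_derivation k a \<in> carrier L}"

definition basis_op :: "(nat \<Rightarrow>\<^sub>0 nat) \<times> nat \<Rightarrow> operator" where
  "basis_op = (\<lambda>(a, k). monomial_derivation k a)"

text \<open>A vector field is determined by its values at the variables: the coefficient of
  \<open>\<partial>\<^sub>k\<close> is the value at \<open>x\<^sub>k\<close>.\<close>

definition coordinate :: "(nat \<Rightarrow>\<^sub>0 nat) \<times> nat \<Rightarrow> operator \<Rightarrow> complex" where
  "coordinate = (\<lambda>(a, k) T. Poly_Mapping.lookup (T (var k)) a)"

lemma edge: "(j, k) \<in> E \<Longrightarrow> 1 \<le> j \<and> j < k \<and> k \<le> n \<and> 0 < d (j, k)"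
  using diagram by (auto simp: oriented_tree_diagram_def oriented_tree_def)

lemma finite_E: "finite E"
  by (rule finite_subset[of _ "{1..n} \<times> {1..n}"]) (use edge in fastforce, simp)

lemma d_le_base: "e \<in> E \<Longrightarrow> d e \<le> base"
  using member_le_sum[of e E d] finite_E by (simp add: base_def)

lemma base_pos: "0 < base"
  by (simp add: base_def)

lemma weight_add: "weight (a + c) = weight a + weight c"
  by (simp add: weight_def lookup_add distrib_right sum.distrib)

lemma weight_single: "weight (Poly_Mapping.single j m) = (if j \<in> {1..n} then m * base ^ j else 0)"
proof -
  have "weight (Poly_Mapping.single j m) = (\<Sum>i = 1..n. if i = j then m * base ^ i else 0)"
    unfolding weight_def by (intro sum.cong) (auto simp: lookup_single when_def)
  then show ?thesis by simp
qed

lemma lookup_le_weight: "i \<in> {1..n} \<Longrightarrow> Poly_Mapping.lookup a i \<le> weight a"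
proof -
  assume i: "i \<in> {1..n}"
  have "Poly_Mapping.lookup a i \<le> Poly_Mapping.lookup a i * base ^ i" using base_pos by simp
  also have "\<dots> \<le> weight a" unfolding weight_def using i by (intro member_le_sum) auto
  finally show ?thesis .
qed

lemma finite_indices: "finite indices"
proof -
  let ?F = "{f. \<forall>i. (i \<in> {1..n} \<longrightarrow> f i \<in> {..base ^ n}) \<and> (i \<notin> {1..n} \<longrightarrow> f i = 0)} :: (nat \<Rightarrow> nat) set"
  have "finite ?F" by (intro finite_set_of_finite_funs) auto
  then have "finite ((\<lambda>a. Poly_Mapping.lookup a) -` ?F)"
    by (intro finite_vimageI injI) (auto simp: lookup_inject)
  moreover have "Poly_Mapping.lookup a \<in> ?F" "k \<in> {1..n}" if "(a, k) \<in> indices" for a k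
  proof -
    have k: "k \<in> {1..n}" "weight a \<le> base ^ k"
      and supp: "Poly_Mapping.lookup a i \<noteq> 0 \<Longrightarrow> 1 \<le> i \<and> i < k" for i
      using that by (auto simp: indices_def admissible_def)
    have "base ^ k \<le> base ^ n" using k base_pos by (intro power_increasing) auto
    then have "Poly_Mapping.lookup a i \<le> base ^ n" if "i \<in> {1..n}" for i
      using lookup_le_weight[OF that, of a] k by simp
    moreover have "Poly_Mapping.lookup a i = 0" if "i \<notin> {1..n}" for i
      using supp[of i] that k by (cases "Poly_Mapping.lookup a i = 0") auto
    ultimately show "Poly_Mapping.lookup a \<in> ?F" "k \<in> {1..n}" using k by auto
  qed
  then have "indices \<subseteq> ((\<lambda>a. Poly_Mapping.lookup a) -` ?F) \<times> {1..n}" by auto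
  ultimately show ?thesis by (meson finite_SigmaI finite_atLeastAtMost finite_subset)
qed

text \<open>Along an edge \<open>(j, k)\<close>, repeated brackets with \<open>\<partial>\<^sub>j\<close>
  lower the exponent of \<open>x\<^sub>j\<close> in the generator \<open>x\<^sub>j\<^sup>d
  \<partial>\<^sub>k\<close> down to \<open>0\<close>. Starting from the roots, this yields all
  partial derivatives.\<close>

lemma partials_in_L: "k \<in> {1..n} \<Longrightarrow> pderiv_op k \<in> carrier L"
proof (induction k rule: less_induct)
  case (less k)
  show ?case
  proof (cases "k \<in> root_nodes n E")
    case True
    then show ?thesis by (auto simp: L_simps tree_generators_def intro: lie_span.gen)
  next
    case False
    then obtain j where j: "(j, k) \<in> E" using less.prems by (auto simp: root_nodes_def)
    have pj: "pderiv_op j \<in> carrier L" using edge[OF j] less.IH[of j] by auto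
    have "monomial_derivation k (Poly_Mapping.single j m) \<in> carrier L" if "m \<le> d (j, k)" for m
      using that
    proof (induction "d (j, k) - m" arbitrary: m)
      case 0
      then have "monomial_derivation k (Poly_Mapping.single j m) = (\<lambda>p. var j ^ d (j, k) * pderiv_op k p)"
        by (simp add: fun_eq_iff monomial_derivation_def var_power)
      then show ?case using j by (auto simp: L_simps tree_generators_def intro!: lie_span.gen)
    next
      case (Suc r)
      let ?T = "monomial_derivation k (Poly_Mapping.single j (Suc m))"
      have T: "?T \<in> carrier L" using Suc by (intro Suc.hyps(1)) auto
      have "pderiv_op j (?T p) - ?T (pderiv_op j p)
          = const (of_nat (Suc m)) * monomial_derivation k (Poly_Mapping.single j m) p" for p
        by (simp add: monomial_derivation_def pderiv_op_mult pderiv_op_single pderiv_op_commute[of j k]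
            const_mult_single single_diff[symmetric] flip: mult.assoc)
      then have "monomial_derivation k (Poly_Mapping.single j m)
          = (\<lambda>p. const (1 / of_nat (Suc m)) * (pderiv_op j (?T p) - ?T (pderiv_op j p)))"
        by (simp add: fun_eq_iff const_mult_const const_1 del: of_nat_Suc flip: mult.assoc)
      then show ?case using L_closed(3)[OF L_closed(4)[OF pj T]] by simp
    qed
    from this[of 0] show ?thesis by (simp add: monomial_derivation_def[abs_def])
  qed
qed

lemma generators_in_span:
  assumes "T \<in> tree_generators n E d"
  shows "T \<in> basis_op ` indices"
proof -
  have TL: "T \<in> carrier L" using assms by (auto simp: L_simps intro: lie_span.gen)
  consider i where "T = pderiv_op i" "i \<in> {1..n}"
    | j k where "T = (\<lambda>p. var j ^ d (j, k) * pderiv_op k p)" "(j, k) \<in> E"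
    using assms by (auto simp: tree_generators_def root_nodes_def)
  then show ?thesis
  proof cases
    case 1
    then have "T = basis_op (0, i)" by (simp add: basis_op_def monomial_derivation_def[abs_def])
    moreover have "(0, i) \<in> indices"
      using TL 1 calculation by (simp add: indices_def basis_op_def admissible_def weight_def)
    ultimately show ?thesis by blast
  next
    case 2
    then have T: "T = basis_op (Poly_Mapping.single j (d (j, k)), k)"
      by (simp add: basis_op_def monomial_derivation_def[abs_def] var_power)
    have "d (j, k) * base ^ j \<le> base ^ Suc j" using d_le_base[OF 2(2)] by simp
    also have "\<dots> \<le> base ^ k" using edge[OF 2(2)] base_pos by (intro power_increasing) auto
    finally have "(Poly_Mapping.single j (d (j, k)), k) \<in> indices"
      using TL 2(2) T edge[OF 2(2)]
      by (auto simp: indices_def basis_op_def admissible_def weight_single nonsink_def lookup_single when_def)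
    then show ?thesis using T by blast
  qed
qed

end

lemma (in alternating_algebra) vectorspace_lie_center: "vectorspace class_ring (lie_center L)"
proof -
  let ?Z = "{z \<in> carrier L. \<forall>x \<in> carrier L. bracket L z x = \<zero>\<^bsub>L\<^esub>}"
  have "bracket L \<zero>\<^bsub>L\<^esub> x = \<zero>\<^bsub>L\<^esub>" if "x \<in> carrier L" for x
    using bracket_smult_left[of "\<zero>\<^bsub>L\<^esub>" x 0] that L.lmult_0[of "\<zero>\<^bsub>L\<^esub>"]
      L.lmult_0[of "bracket L \<zero>\<^bsub>L\<^esub> x"] by (simp add: bracket_closed)
  moreover have "c \<odot>\<^bsub>L\<^esub> \<zero>\<^bsub>L\<^esub> = \<zero>\<^bsub>L\<^esub>" for c by simp
  ultimately have "submodule class_ring ?Z L"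
    by unfold_locales (auto simp: bracket_add_left bracket_smult_left)
  then have "subspace class_ring ?Z L" using vs by (simp add: subspace_def)
  then show ?thesis unfolding lie_center_def by (rule L.subspace_is_vs)
qed

context tree_diagram
begin

lemma indicesD:
  assumes "(a, k) \<in> indices"
  shows "k \<in> {1..n}" "weight a \<le> base ^ k" "monomial_derivation k a \<in> carrier L"
    "Poly_Mapping.lookup a i \<noteq> 0 \<Longrightarrow> 1 \<le> i \<and> i < k \<and> nonsink i"
  using assms by (auto simp: indices_def admissible_def)

lemma bracket_basis_zero:
  assumes "Poly_Mapping.lookup c j = 0" "Poly_Mapping.lookup a k = 0"
  shows "bracket L (basis_op (a, j)) (basis_op (c, k)) = \<zero>\<^bsub>L\<^esub>"
  using bracket_monomial_derivations[of n j a k c] assms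
  by (simp add: L_simps basis_op_def diff_op_algebra_def const_0 fun_eq_iff)

text \<open>At most one of the two terms of the bracket of \<open>x\<^sup>a \<partial>\<^sub>j\<close> and
  \<open>x\<^sup>c \<partial>\<^sub>k\<close> is nonzero, because coefficients involve only
  variables of smaller index. So the bracket is a multiple of one monomial field, which therefore
  lies in the algebra itself. Its exponent differs from \<open>c\<close>: the exponent of
  \<open>x\<^sub>j\<close> drops, as \<open>x\<^sup>a\<close> does not contain
  \<open>x\<^sub>j\<close>.\<close>

lemma bracket_basis_step:
  assumes a: "(a, j) \<in> indices" and c: "(c, k) \<in> indices" and cj: "Poly_Mapping.lookup c j \<noteq> 0"
  defines "m \<equiv> a + (c - Poly_Mapping.single j 1)"
  shows "bracket L (basis_op (a, j)) (basis_op (c, k))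
      = of_nat (Poly_Mapping.lookup c j) \<odot>\<^bsub>L\<^esub> basis_op (m, k)"
    and "(m, k) \<in> indices" and "m \<noteq> c"
proof -
  let ?B = "bracket L (basis_op (a, j)) (basis_op (c, k))"
  have jk: "j < k" using indicesD(4)[OF c cj] by auto
  have ak: "Poly_Mapping.lookup a k = 0" using indicesD(4)[OF a, of k] jk by auto
  have aj: "Poly_Mapping.lookup a j = 0" using indicesD(4)[OF a, of j] by auto
  show B: "?B = of_nat (Poly_Mapping.lookup c j) \<odot>\<^bsub>L\<^esub> basis_op (m, k)"
    using bracket_monomial_derivations[of n j a k c] ak
    by (simp add: L_simps basis_op_def diff_op_algebra_def const_0 fun_eq_iff m_def)
  have "?B \<in> carrier L"
    using indicesD(3)[OF a] indicesD(3)[OF c] by (intro bracket_closed) (simp_all add: basis_op_def)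
  then have "(1 / of_nat (Poly_Mapping.lookup c j)) \<odot>\<^bsub>L\<^esub> ?B \<in> carrier L" by simp
  then have mL: "monomial_derivation k m \<in> carrier L"
    using cj unfolding B by (simp add: L_simps(3) basis_op_def const_mult_const const_1 flip: mult.assoc)
  have c_split: "c = (c - Poly_Mapping.single j 1) + Poly_Mapping.single j 1"
    using cj by (intro poly_mapping_eqI) (auto simp: lookup_add lookup_minus lookup_single when_def)
  have "weight c = weight (c - Poly_Mapping.single j 1) + base ^ j"
    using indicesD(1)[OF a] by (subst c_split, subst weight_add) (simp add: weight_single)
  then have "weight m \<le> base ^ k"
    using indicesD(2)[OF a] indicesD(2)[OF c] by (simp add: m_def weight_add)
  moreover have "1 \<le> i \<and> i < k \<and> nonsink i" if "Poly_Mapping.lookup m i \<noteq> 0" for i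
  proof -
    have "Poly_Mapping.lookup a i \<noteq> 0 \<or> Poly_Mapping.lookup c i \<noteq> 0"
      using that by (auto simp: m_def lookup_add lookup_minus)
    then show ?thesis using indicesD(4)[OF a, of i] indicesD(4)[OF c, of i] jk by auto
  qed
  ultimately show "(m, k) \<in> indices"
    using mL indicesD(1)[OF c] by (simp add: indices_def admissible_def)
  have "Poly_Mapping.lookup m j \<noteq> Poly_Mapping.lookup c j"
    using aj cj by (simp add: m_def lookup_add lookup_minus)
  then show "m \<noteq> c" by auto
qed

lemma bracket_swap: "bracket L S T = (- 1) \<odot>\<^bsub>L\<^esub> bracket L T S"
proof -
  have "const (- 1) * p = - p" for p :: cpoly
    by (intro poly_mapping_eqI) (simp add: lookup_const_mult)
  then show ?thesis by (simp add: L_simps fun_eq_iff)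
qed

lemma basis_op_carrier: "i \<in> indices \<Longrightarrow> basis_op i \<in> carrier L"
  by (auto simp: indices_def basis_op_def)

lemma basis_spanning: "carrier L \<subseteq> lin_span L (basis_op ` indices)"
proof
  let ?G = "basis_op ` indices"
  have sub: "?G \<subseteq> carrier L" using basis_op_carrier by auto
  have step: "bracket L (basis_op (a, j)) (basis_op (c, k)) \<in> lin_span L ?G"
    if "(a, j) \<in> indices" "(c, k) \<in> indices" "Poly_Mapping.lookup c j \<noteq> 0" for a j c k
    unfolding bracket_basis_step(1)[OF that]
    by (intro lin_span.smult lin_span.gen imageI bracket_basis_step(2)[OF that])
  have br: "bracket L x y \<in> lin_span L ?G" if xy: "x \<in> ?G" "y \<in> ?G" for x y
  proof -
    obtain a j c k where *: "x = basis_op (a, j)" "y = basis_op (c, k)" "(a, j) \<in> indices" "(c, k) \<in> indices"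
      using xy by auto
    consider "Poly_Mapping.lookup c j \<noteq> 0" | "Poly_Mapping.lookup a k \<noteq> 0"
      | "Poly_Mapping.lookup c j = 0" "Poly_Mapping.lookup a k = 0" by blast
    then show ?thesis
    proof cases
      case 1
      then show ?thesis unfolding * by (rule step[OF *(3,4)])
    next
      case 2
      then have "bracket L y x \<in> lin_span L ?G" unfolding * by (rule step[OF *(4,3)])
      then show ?thesis by (subst bracket_swap) (rule lin_span.smult)
    next
      case 3
      then show ?thesis using bracket_basis_zero lin_span.zero[of L] unfolding * by simp
    qed
  qed
  fix T assume "T \<in> carrier L"
  then show "T \<in> lin_span L ?G"
    unfolding L_simps(5)
  proof induction
    case (gen T)
    then show ?case using generators_in_span by (auto intro: lin_span.gen)
  next
    case zero
    then show ?case using lin_span.zero[of L ?G] by (simp add: L_simps diff_op_algebra_def)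
  next
    case (add S T)
    then show ?case using lin_span.add[of S L ?G T] by (simp add: L_simps diff_op_algebra_def)
  next
    case (smult T c)
    then show ?case using lin_span.smult[of T L ?G c] by (simp add: L_simps diff_op_algebra_def)
  next
    case (bracket S T)
    then show ?case
      using bracket_lin_span[OF sub br, of S T] by (simp add: L_simps diff_op_algebra_def)
  qed
qed

lemma coordinate_basis_op: "coordinate i (basis_op j) = (if i = j then 1 else 0)"
  by (cases i; cases j)
    (auto simp: coordinate_def basis_op_def monomial_derivation_var lookup_single when_def)

lemma coordinate_smult: "coordinate i (c \<odot>\<^bsub>L\<^esub> T) = c * coordinate i T"
  by (cases i) (simp add: coordinate_def L_simps lookup_const_mult)

sublocale based_alternating_algebra L indices basis_op coordinate
proof
  show "linear_functional L (coordinate i)" for i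
    by (cases i) (simp add: linear_functional_def coordinate_smult, simp add: coordinate_def L_simps lookup_add)
qed (use finite_indices basis_op_carrier basis_spanning coordinate_basis_op in auto)

lemma partials_in_indices: "k \<in> {1..n} \<Longrightarrow> (0, k) \<in> indices"
  using partials_in_L[of k]
  by (simp add: indices_def admissible_def weight_def monomial_derivation_def[abs_def])

text \<open>For a set \<open>S\<close> of sinks take all basis fields with direction in \<open>S\<close>. They
  span an abelian ideal, and a bracket with direction in \<open>S\<close> comes from a basis field
  with the same direction and a different coefficient. Different sets \<open>S\<close> give
  different families, since \<open>\<partial>\<^sub>k\<close> belongs to the family of
  \<open>S\<close> exactly when \<open>k \<in> S\<close>.\<close>

lemma two_power_card_sinks_le_dim: "2 ^ card sinks \<le> cdim (total_cohomology L)"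
proof -
  define U where "U S = {(a, k) \<in> indices. k \<in> S}" for S
  have "inj_on U (Pow sinks)"
  proof
    fix S T assume "S \<in> Pow sinks" "T \<in> Pow sinks" "U S = U T"
    then have "k \<in> S \<longleftrightarrow> k \<in> T" if "k \<in> sinks" for k
      using partials_in_indices[of k] that by (auto simp: U_def sinks_def set_eq_iff)
    then show "S = T" using \<open>S \<in> Pow sinks\<close> \<open>T \<in> Pow sinks\<close> by blast
  qed
  then have "2 ^ card sinks = card (U ` Pow sinks)"
    by (simp add: card_image card_Pow sinks_def)
  also have "\<dots> \<le> cdim (total_cohomology L)"
  proof (rule card_le_dim_total_cohomology)
    show "U ` Pow sinks \<subseteq> Pow indices" by (auto simp: U_def)
  next
    fix V x y u
    assume "V \<in> U ` Pow sinks" and x: "x \<in> indices" and y: "y \<in> indices" and u: "u \<in> V"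
      and nz: "coordinate u (bracket L (basis_op x) (basis_op y)) \<noteq> 0"
    then obtain S where V: "V = U S" by auto
    have step: "y \<in> V - {u}"
      if "Poly_Mapping.lookup (fst y) (snd x) \<noteq> 0" and x: "x \<in> indices" and y: "y \<in> indices"
        and nz: "coordinate u (bracket L (basis_op x) (basis_op y)) \<noteq> 0" for x y
    proof -
      obtain a j c k where xy: "x = (a, j)" "y = (c, k)" by fastforce
      from bracket_basis_step[of a j c k] that obtain m where
        "bracket L (basis_op x) (basis_op y) = of_nat (Poly_Mapping.lookup c j) \<odot>\<^bsub>L\<^esub> basis_op (m, k)" "m \<noteq> c"
        unfolding xy by auto
      then have "u = (m, k)" "m \<noteq> c" using nz by (auto simp: coordinate_smult coordinate_basis_op split: if_splits)
      then show ?thesis using u y xy by (auto simp: V U_def)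
    qed
    obtain a j c k where xy: "x = (a, j)" "y = (c, k)" by fastforce
    consider "Poly_Mapping.lookup c j \<noteq> 0" | "Poly_Mapping.lookup a k \<noteq> 0"
      | "Poly_Mapping.lookup c j = 0" "Poly_Mapping.lookup a k = 0" by blast
    then show "x \<in> V - {u} \<or> y \<in> V - {u}"
    proof cases
      case 1
      then show ?thesis using step[of y x] x y nz xy by auto
    next
      case 2
      have "coordinate u (bracket L (basis_op y) (basis_op x)) \<noteq> 0"
        using nz bracket_swap[of "basis_op x" "basis_op y"] by (auto simp: coordinate_smult)
      then show ?thesis using 2 step[of x y] x y xy by auto
    next
      case 3
      then show ?thesis
        using nz bracket_basis_zero[of c j a k] coordinate_smult[of u 0 "\<zero>\<^bsub>L\<^esub>"] L.lmult_0[of "\<zero>\<^bsub>L\<^esub>"]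
        by (simp add: xy)
    qed
  next
    fix V x y assume "V \<in> U ` Pow sinks" "x \<in> V" "y \<in> V"
    then obtain S where S: "S \<subseteq> sinks" "x \<in> U S" "y \<in> U S" by auto
    obtain a j c k where xy: "x = (a, j)" "y = (c, k)" by fastforce
    then have "(a, j) \<in> indices" "(c, k) \<in> indices" "j \<in> sinks" "k \<in> sinks"
      using S by (auto simp: U_def)
    then have "Poly_Mapping.lookup c j = 0" "Poly_Mapping.lookup a k = 0"
      using indicesD(4)[of c k j] indicesD(4)[of a j k] by (auto simp: sinks_def)
    then show "bracket L (basis_op x) (basis_op y) = \<zero>\<^bsub>L\<^esub>"
      unfolding xy by (rule bracket_basis_zero)
  qed
  finally show ?thesis .
qed

section \<open>The centre\<close>

lemma operator_determined_by_vars: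
  assumes "T \<in> carrier L"
  shows "T p = (\<Sum>k = 1..n. T (var k) * pderiv_op k p)"
proof -
  have "T \<in> lin_span L (basis_op ` indices)" using assms basis_spanning by auto
  then show ?thesis
  proof induction
    case (gen T)
    then obtain a k where T: "(a, k) \<in> indices" "T = monomial_derivation k a"
      by (auto simp: basis_op_def)
    have "(\<Sum>l = 1..n. T (var l) * pderiv_op l p) = (\<Sum>l = 1..n. if l = k then T p else 0)"
      by (intro sum.cong) (auto simp: T monomial_derivation_var, simp add: monomial_derivation_def)
    then show ?case using indicesD(1)[OF T(1)] by simp
  qed (simp_all add: L_simps distrib_right sum.distrib sum_distrib_left mult.assoc)
qed

lemma coefficient_variables:
  assumes "T \<in> carrier L" "Poly_Mapping.lookup (T (var k)) m \<noteq> 0" "Poly_Mapping.lookup m i \<noteq> 0"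
  shows "i \<in> {1..n}"
proof (rule ccontr)
  assume i: "i \<notin> {1..n}"
  have "T \<in> lin_span L (basis_op ` indices)" using assms basis_spanning by auto
  then have "Poly_Mapping.lookup (T (var k)) m = 0"
  proof induction
    case (gen T)
    then obtain a l where T: "(a, l) \<in> indices" "T = monomial_derivation l a"
      by (auto simp: basis_op_def)
    then have "Poly_Mapping.lookup a i = 0"
      using indicesD(1)[OF T(1)] indicesD(4)[OF T(1), of i] i
      by (cases "Poly_Mapping.lookup a i = 0") auto
    then have "a \<noteq> m" using assms(3) by auto
    then show ?case by (simp add: T monomial_derivation_var lookup_single when_def)
  qed (simp_all add: L_simps lookup_add lookup_const_mult)
  then show False using assms(2) by simp
qed

text \<open>A central element is a combination of the \<open>\<partial>\<^sub>k\<close> over the sinks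
  \<open>k\<close>, so the coefficients of these \<open>\<partial>\<^sub>k\<close> separate the
  points of the centre.\<close>

lemma dim_center_le: "cdim (lie_center L) \<le> card sinks"
proof -
  let ?e = "\<lambda>k T. Poly_Mapping.lookup (T (var k)) 0"
  have car: "carrier (lie_center L) = {z \<in> carrier L. \<forall>x \<in> carrier L. bracket L z x = \<zero>\<^bsub>L\<^esub>}"
    by (simp add: lie_center_def)
  have "vectorspace.fin_dim class_ring (lie_center L) \<and> cdim (lie_center L) \<le> card sinks"
  proof (rule dim_le_card_separating_functionals[where e = ?e, OF vectorspace_lie_center])
    show "finite sinks" by (simp add: sinks_def)
    show "linear_functional (lie_center L) (?e k)" for k
      by (simp add: linear_functional_def lie_center_def L_simps(2,3) lookup_add lookup_const_mult)
  next
    fix T assume "T \<in> carrier (lie_center L)" and sinks0: "\<And>k. k \<in> sinks \<Longrightarrow> ?e k T = 0"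
    then have TL: "T \<in> carrier L" and comm: "\<And>S p. S \<in> carrier L \<Longrightarrow> T (S p) = S (T p)"
      by (auto simp: car L_simps(1,4) fun_eq_iff)
    note T_expand = operator_determined_by_vars[OF TL]
    \<comment> \<open>commuting with the partial derivatives leaves only constant coefficients\<close>
    have const_coeff: "Poly_Mapping.lookup (T (var k)) m = 0" if m: "m \<noteq> 0" for k m
    proof (rule ccontr)
      assume nz: "Poly_Mapping.lookup (T (var k)) m \<noteq> 0"
      obtain i where i: "Poly_Mapping.lookup m i \<noteq> 0"
        using m by (metis lookup_zero poly_mapping_eqI)
      then have "i \<in> {1..n}" using coefficient_variables[OF TL nz] by simp
      have "pderiv_op i (T (var k)) = T (pderiv_op i (var k))"
        using comm[OF partials_in_L[OF \<open>i \<in> {1..n}\<close>]] by simp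
      also have "\<dots> = 0"
      proof -
        have "pderiv_op l 1 = 0" for l
          using pderiv_op_single[of l 0 1] by simp
        then have "T 1 = 0" "T 0 = 0" using T_expand[of 1] T_expand[of 0] by (simp_all add: pderiv_op_0)
        then show ?thesis by (simp add: pderiv_op_var)
      qed
      finally have "Poly_Mapping.lookup (pderiv_op i (T (var k))) (m - Poly_Mapping.single i 1) = 0"
        by simp
      moreover have "m - Poly_Mapping.single i 1 + Poly_Mapping.single i 1 = m"
        using i by (intro poly_mapping_eqI) (auto simp: lookup_add lookup_minus lookup_single when_def)
      ultimately show False using nz by (simp add: lookup_pderiv_op del: of_nat_Suc)
    qed
    define c where "c k = ?e k T" for k
    have T_var: "T (var k) = const (c k)" for k
      by (intro poly_mapping_eqI) (auto simp: c_def const_def lookup_single when_def const_coeff)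
    \<comment> \<open>commuting with the generator of an outgoing edge kills the constant at a non-sink\<close>
    have "c k = 0" if k: "k \<in> {1..n}" for k
    proof (cases "nonsink k")
      case False
      then show ?thesis using sinks0 k by (simp add: c_def sinks_def)
    next
      case True
      then obtain l where l: "(k, l) \<in> E" by (auto simp: nonsink_def)
      define r where "r = d (k, l)"
      have r: "r > 0" using edge[OF l] by (simp add: r_def)
      let ?S = "\<lambda>p. var k ^ r * pderiv_op l p"
      have "?S \<in> carrier L"
        using l by (auto simp: L_simps(5) tree_generators_def r_def intro!: lie_span.gen)
      from comm[OF this, of "var l"] have "T (var k ^ r) = 0"
        by (simp add: pderiv_op_var T_var const_def pderiv_op_single)
      moreover have "T (var k ^ r) = (\<Sum>j = 1..n. if j = k then
          const (c k) * Poly_Mapping.single (Poly_Mapping.single k (r - 1)) (of_nat r) else 0)"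
        unfolding T_expand[of "var k ^ r"]
        by (intro sum.cong)
          (auto simp: T_var var_power pderiv_op_single lookup_single when_def simp flip: single_diff)
      ultimately have "Poly_Mapping.single (Poly_Mapping.single k (r - 1)) (c k * of_nat r) = 0"
        using k by (simp add: const_mult_single)
      then have "c k * of_nat r = 0" by (metis lookup_single_eq lookup_zero)
      then show ?thesis using r by simp
    qed
    then have "T p = 0" for p
      unfolding T_expand[of p] by (intro sum.neutral) (simp add: T_var const_0)
    then show "T = \<zero>\<^bsub>lie_center L\<^esub>" by (simp add: lie_center_def L_simps fun_eq_iff)
  qed
  then show ?thesis ..
qed

end

theorem theorem3p4:
  fixes n :: nat and E :: "(nat \<times> nat) set" and d :: "nat \<times> nat \<Rightarrow> nat"
  assumes "oriented_tree_diagram n E d"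
  shows "cdim (total_cohomology (tree_lie_algebra n E d))
           \<ge> 2 ^ cdim (lie_center (tree_lie_algebra n E d))"
proof -
  interpret tree_diagram n E d by standard (rule assms)
  have "(2 :: nat) ^ cdim (lie_center L) \<le> 2 ^ card sinks"
    using dim_center_le by (intro power_increasing) auto
  also have "\<dots> \<le> cdim (total_cohomology L)" by (rule two_power_card_sinks_le_dim)
  finally show ?thesis .
qed

end
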